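(* Let $G_\bullet$ be a finitely generated $\mathrm{FI}$-graph, and for each $n$ let $X_{t,n}$ denote the simple random walk on $G_n$. Let $m \gg 0$ and let $x,y$ be vertices of $G_m$. For $n \ge m$ put $x(n) := G(\iota_{m,n})(x)$ and $y(n) := G(\iota_{m,n})(y)$, where $\iota_{m,n}:[m]\hookrightarrow[n]$ is the standard inclusion, and let $\tau_{x,y}(n)$ denote the hitting time from $x(n)$ to $y(n)$ for the simple random walk on $G_n$. Then for all $n \geq m$ and all $i \geq 1$, the function \[ n \mapsto \mu_i(\tau_{x,y}(n)) \] agrees with a rational function of $n$, where $\mu_i$ denotes any one of: the $i$-th moment, the $i$-th central moment, or the $i$-th cumulant.
   Context: $\mathrm{FI}$ denotes the category whose objects are the sets $[n]=\{1,\dots,n\}$ ($n\ge 0$) and whose morphisms are injective maps. A graph is a finite vertex set $V$ with a set of edges $E\subseteq \binom{V}{2}\cup V$ (elements of $E\cap V$ are loops); a graph homomorphism is a map of vertex sets sending edges to edges. An $\mathrm{FI}$-graph $G_\bullet$ is a functor from $\mathrm{FI}$ to the category of graphs and graph homomorphisms; $G_n$ denotes its value on $[n]$ and $G(f)$ the map induced by an injection $f$. It is finitely generated if there is $d$ such that for all $n\ge d$ every vertex of $G_{n+1}$ lies in the image of $G(f)$ for some injection $f:[n]\hookrightarrow[n+1]$. Standing assumption: all graphs considered are connected (so $G_n$ is connected for the relevant $n$). The simple random walk on a graph moves from $v$ to $u$ with probability $w_{v,u}/d_v$, where $w_{v,u}=1$ if $\{v,u\}$ is an edge with $v\neq u$,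 $w_{v,v}=2$ if $v$ has a loop, $w=0$ otherwise, and $d_v=\sum_u w_{v,u}$. The hitting time from $a$ to $b$ is the random variable $\tau_{a,b}=\min\{t\ge 0 : X_t=b\}$ for the walk started at $X_0=a$. *)

theory Defs
  imports "HOL-Probability.Probability" "HOL-Computational_Algebra.Polynomial"
begin

section \<open>Graphs\<close>

text \<open>A graph is a pair of a vertex set and an edge set.  An edge is the set of its
  endpoints, so that a loop at \<open>v\<close> is the singleton \<open>{v}\<close>.\<close>

type_synonym 'v graph = "'v set \<times> 'v set set"

abbreviation verts :: "'v graph \<Rightarrow> 'v set" where "verts \<equiv> fst"
abbreviation edges :: "'v graph \<Rightarrow> 'v set set" where "edges \<equiv> snd"

definition is_graph :: "'v graph \<Rightarrow> bool" where
  "is_graph H \<longleftrightarrow> finite (verts H) \<and>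
     (\<forall>e\<in>edges H. e \<subseteq> verts H \<and> (card e = 1 \<or> card e = 2))"

definition graph_hom :: "'v graph \<Rightarrow> 'v graph \<Rightarrow> ('v \<Rightarrow> 'v) \<Rightarrow> bool" where
  "graph_hom H K \<phi> \<longleftrightarrow> \<phi> ` verts H \<subseteq> verts K \<and> (\<forall>e\<in>edges H. \<phi> ` e \<in> edges K)"

definition connected_graph :: "'v graph \<Rightarrow> bool" where
  "connected_graph H \<longleftrightarrow>
     (\<forall>u\<in>verts H. \<forall>v\<in>verts H. (u, v) \<in> {(a, b). {a, b} \<in> edges H}\<^sup>*)"

section \<open>FI-graphs\<close>

text \<open>Injections between the sets \<open>{1..m}\<close> and \<open>{1..n}\<close> are represented by
  extensional functions, so that each morphism of FI has exactly one representative.\<close>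

definition FI_hom :: "nat \<Rightarrow> nat \<Rightarrow> (nat \<Rightarrow> nat) set" where
  "FI_hom m n = {f \<in> {1..m} \<rightarrow>\<^sub>E {1..n}. inj_on f {1..m}}"

text \<open>The standard inclusion of \<open>{1..m}\<close> into any \<open>{1..n}\<close> with \<open>m \<le> n\<close>;
  for \<open>n = m\<close> it is the identity morphism.\<close>

definition FI_incl :: "nat \<Rightarrow> nat \<Rightarrow> nat" where
  "FI_incl m = (\<lambda>i\<in>{1..m}. i)"

text \<open>\<open>Gmap m n f\<close> is the map induced by \<open>f \<in> FI_hom m n\<close>; only its values on the
  vertices of \<open>G m\<close> are meaningful.\<close>

locale FI_graph =
  fixes G :: "nat \<Rightarrow> 'v graph"
    and Gmap :: "nat \<Rightarrow> nat \<Rightarrow> (nat \<Rightarrow> nat) \<Rightarrow> 'v \<Rightarrow> 'v"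
  assumes graph: "is_graph (G n)"
    and hom: "f \<in> FI_hom m n \<Longrightarrow> graph_hom (G m) (G n) (Gmap m n f)"
    and map_id: "v \<in> verts (G n) \<Longrightarrow> Gmap n n (FI_incl n) v = v"
    and map_comp: "\<lbrakk>f \<in> FI_hom l m; g \<in> FI_hom m n; v \<in> verts (G l)\<rbrakk> \<Longrightarrow>
       Gmap l n (compose {1..l} g f) v = Gmap m n g (Gmap l m f v)"

definition finitely_generated ::
    "(nat \<Rightarrow> 'v graph) \<Rightarrow> (nat \<Rightarrow> nat \<Rightarrow> (nat \<Rightarrow> nat) \<Rightarrow> 'v \<Rightarrow> 'v) \<Rightarrow> bool" where
  "finitely_generated G Gmap \<longleftrightarrow>
     (\<exists>d. \<forall>n\<ge>d. \<forall>v\<in>verts (G (Suc n)).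
        \<exists>f\<in>FI_hom n (Suc n). v \<in> Gmap n (Suc n) f ` verts (G n))"

section \<open>Simple random walk and hitting times\<close>

definition weight :: "'v graph \<Rightarrow> 'v \<Rightarrow> 'v \<Rightarrow> real" where
  "weight H v u = (if {v, u} \<in> edges H then (if u = v then 2 else 1) else 0)"

definition wdegree :: "'v graph \<Rightarrow> 'v \<Rightarrow> real" where
  "wdegree H v = (\<Sum>u\<in>verts H. weight H v u)"

text \<open>At a vertex of degree zero the quotient is meaningless, and the walk is taken to stay
  put.  In a connected graph this only concerns the graph with one vertex and no loop.\<close>

definition step_prob :: "'v graph \<Rightarrow> 'v \<Rightarrow> 'v \<Rightarrow> real" where
  "step_prob H v u =
     (if wdegree H v = 0 then (if u = v then 1 else 0) else weight H v u / wdegree H v)"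

text \<open>The process \<open>X\<close> on the probability space \<open>M\<close> is a simple random walk on \<open>H\<close>
  started at \<open>a\<close>: given any history of positive probability, the next step is distributed
  according to the transition probabilities from the current vertex.\<close>

definition simple_random_walk ::
    "'w measure \<Rightarrow> 'v graph \<Rightarrow> 'v \<Rightarrow> (nat \<Rightarrow> 'w \<Rightarrow> 'v) \<Rightarrow> bool" where
  "simple_random_walk M H a X \<longleftrightarrow>
     prob_space M \<and>
     (\<forall>t. X t \<in> measurable M (count_space (verts H))) \<and>
     (AE \<omega> in M. X 0 \<omega> = a) \<and>
     (\<forall>t v. \<forall>u\<in>verts H.
        \<P>(\<omega> in M. \<forall>s\<le>t. X s \<omega> = v s) > 0 \<longrightarrow>
        \<P>(\<omega> in M. X (Suc t) \<omega> = u \<bar> \<forall>s\<le>t. X s \<omega> = v s) = step_prob H (v t) u)"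

text \<open>The infimum of the empty set is \<open>\<infinity>\<close>.\<close>

definition hitting_time :: "(nat \<Rightarrow> 'w \<Rightarrow> 'v) \<Rightarrow> 'v \<Rightarrow> 'w \<Rightarrow> enat" where
  "hitting_time X b \<omega> = (INF t\<in>{t. X t \<omega> = b}. enat t)"

text \<open>The real-valued version, to be used when the hitting time is almost surely finite;
  the value \<open>\<infinity>\<close> is replaced by \<open>0\<close>.\<close>

definition hitting_time_real :: "(nat \<Rightarrow> 'w \<Rightarrow> 'v) \<Rightarrow> 'v \<Rightarrow> 'w \<Rightarrow> real" where
  "hitting_time_real X b \<omega> = real_of_ereal (ereal_of_enat (hitting_time X b \<omega>))"

section \<open>Moments, central moments, cumulants\<close>

definition moment :: "'w measure \<Rightarrow> ('w \<Rightarrow> real) \<Rightarrow> nat \<Rightarrow> real" where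
  "moment M Z i = (\<integral>\<omega>. Z \<omega> ^ i \<partial>M)"

definition central_moment :: "'w measure \<Rightarrow> ('w \<Rightarrow> real) \<Rightarrow> nat \<Rightarrow> real" where
  "central_moment M Z i = (\<integral>\<omega>. (Z \<omega> - (\<integral>\<omega>'. Z \<omega>' \<partial>M)) ^ i \<partial>M)"

text \<open>The \<open>i\<close>-th derivative at \<open>0\<close> of the cumulant generating function.\<close>

definition cumulant :: "'w measure \<Rightarrow> ('w \<Rightarrow> real) \<Rightarrow> nat \<Rightarrow> real" where
  "cumulant M Z i = (deriv ^^ i) (\<lambda>t. ln (\<integral>\<omega>. exp (t * Z \<omega>) \<partial>M)) 0"

text \<open>Integrability of \<open>exp (t * Z)\<close> for \<open>t\<close> near \<open>0\<close> guarantees that all the integrals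
  and derivatives in the previous three definitions exist.\<close>

definition has_mgf :: "'w measure \<Rightarrow> ('w \<Rightarrow> real) \<Rightarrow> bool" where
  "has_mgf M Z \<longleftrightarrow> (\<exists>\<epsilon>>0. \<forall>t. \<bar>t\<bar> < \<epsilon> \<longrightarrow> integrable M (\<lambda>\<omega>. exp (t * Z \<omega>)))"

definition rational_from :: "nat \<Rightarrow> (nat \<Rightarrow> real) \<Rightarrow> bool" where
  "rational_from m f \<longleftrightarrow>
     (\<exists>p q :: real poly. \<forall>n\<ge>m. poly q (real n) \<noteq> 0 \<and> f n = poly p (real n) / poly q (real n))"

end

theory Submission
  imports Defs "HOL-Real_Asymp.Real_Asymp"
begin

text \<open>By finite generation every vertex of \<open>G n\<close> is a translate of one of finitely many generators
  along an injection \<open>f\<close> of \<open>{1..d}\<close> into \<open>{1..n}\<close>, and for large \<open>n\<close> coincidence and adjacency of two translates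
  depend only on the overlap of the two injections.  Fix the set \<open>A\<close> of at most \<open>2 * d\<close> labels
  occurring in the start and the target.  The walk up to the hitting time lumps to a chain on the pairs of a
  generator and the trace of \<open>f\<close> on \<open>A\<close>.  This state set does not depend on \<open>n\<close>, and
  the transition probabilities are rational in \<open>n\<close>, because the injections with a prescribed trace
  are counted by a falling factorial.  The tail sums \<open>\<Sum>t. t ^ i * P (\<tau> > t)\<close> solve a linear
  system over this chain, hence are rational in \<open>n\<close>; moments, central moments and cumulants are
  rational expressions in them.\<close>

section \<open>Rational functions and linear systems\<close>

text \<open>\<open>rational_from m\<close> asks for one pair of polynomials, the denominator
  vanishing at no n \<ge> m. Hence every division must be backed by a quantity shown to be nonzero
  at each such n: pivots, degrees away from the target, numbers of names of a vertex. A name of a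
  vertex is a pair of a generator w and an injection f. The obstacle in the lumping is that a vertex
  may have several names, even names with different generators and different traces, so the states
  need not partition the vertex set. Sums over vertices are therefore rewritten as sums over all
  names, each weighted by the reciprocal of the number of names of its vertex. Relabelling by
  permutations of {1..n} shows that this number depends on n and w only. Permutations that fix A
  pointwise show in the same way that the weight sent into a state depends only on the trace of the
  current vertex. The rate of geometric decay varies with n; it gives convergence of the series for
  each single n. Uniformity in n comes from the finite algebra, whose shape is the same for all
  n.\<close>

lemma rational_from_cong:
  assumes "rational_from m f" "\<And>n. n \<ge> m \<Longrightarrow> g n = f n"
  shows "rational_from m g"
  using assms unfolding rational_from_def by auto

lemma rational_from_const [intro]: "rational_from m (\<lambda>n. c)"
  unfolding rational_from_def by (intro exI[of _ "[:c:]"] exI[of _ 1]) auto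

lemma rational_from_of_nat [intro]: "rational_from m real"
  unfolding rational_from_def by (intro exI[of _ "[:0, 1:]"] exI[of _ 1]) auto

lemma rational_from_add [intro]:
  assumes "rational_from m f" "rational_from m g"
  shows "rational_from m (\<lambda>n. f n + g n)"
proof -
  obtain p q where pq: "\<And>n. n \<ge> m \<Longrightarrow> poly q (real n) \<noteq> 0 \<and> f n = poly p (real n) / poly q (real n)"
    using assms(1) unfolding rational_from_def by blast
  obtain p' q' where pq': "\<And>n. n \<ge> m \<Longrightarrow> poly q' (real n) \<noteq> 0 \<and> g n = poly p' (real n) / poly q' (real n)"
    using assms(2) unfolding rational_from_def by blast
  show ?thesis
    unfolding rational_from_def
    by (intro exI[of _ "p * q' + p' * q"] exI[of _ "q * q'"]) (simp add: pq pq' add_frac_eq)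
qed

lemma rational_from_mult [intro]:
  assumes "rational_from m f" "rational_from m g"
  shows "rational_from m (\<lambda>n. f n * g n)"
proof -
  obtain p q where pq: "\<And>n. n \<ge> m \<Longrightarrow> poly q (real n) \<noteq> 0 \<and> f n = poly p (real n) / poly q (real n)"
    using assms(1) unfolding rational_from_def by blast
  obtain p' q' where pq': "\<And>n. n \<ge> m \<Longrightarrow> poly q' (real n) \<noteq> 0 \<and> g n = poly p' (real n) / poly q' (real n)"
    using assms(2) unfolding rational_from_def by blast
  show ?thesis
    unfolding rational_from_def
    by (intro exI[of _ "p * p'"] exI[of _ "q * q'"]) (simp add: pq pq')
qed

text \<open>Nonvanishing of \<open>f\<close> at every n \<ge> m passes to its numerator, which is
  then admissible as a denominator on the whole range.\<close>

lemma rational_from_inverse: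
  assumes "rational_from m f" "\<And>n. n \<ge> m \<Longrightarrow> f n \<noteq> 0"
  shows "rational_from m (\<lambda>n. 1 / f n)"
proof -
  obtain p q where pq: "\<And>n. n \<ge> m \<Longrightarrow> poly q (real n) \<noteq> 0 \<and> f n = poly p (real n) / poly q (real n)"
    using assms(1) unfolding rational_from_def by blast
  have "poly p (real n) \<noteq> 0" if "n \<ge> m" for n
    using pq[OF that] assms(2)[OF that] by auto
  then show ?thesis
    unfolding rational_from_def
    by (intro exI[of _ q] exI[of _ p]) (simp add: pq)
qed

lemma rational_from_divide:
  assumes "rational_from m f" "rational_from m g" "\<And>n. n \<ge> m \<Longrightarrow> g n \<noteq> 0"
  shows "rational_from m (\<lambda>n. f n / g n)"
  using rational_from_mult[OF assms(1) rational_from_inverse[OF assms(2,3)]] by simp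

lemma rational_from_diff [intro]:
  assumes "rational_from m f" "rational_from m g"
  shows "rational_from m (\<lambda>n. f n - g n)"
  using rational_from_add[OF assms(1) rational_from_mult[OF rational_from_const[of m "-1"] assms(2)]]
  by simp

lemma rational_from_sum [intro]:
  assumes "\<And>i. i \<in> I \<Longrightarrow> rational_from m (f i)"
  shows "rational_from m (\<lambda>n. \<Sum>i\<in>I. f i n)"
  using assms
proof (induction I rule: infinite_finite_induct)
  case (insert x F)
  then show ?case by (simp add: rational_from_add)
qed (simp_all add: rational_from_const)

lemma rational_from_prod [intro]:
  assumes "\<And>i. i \<in> I \<Longrightarrow> rational_from m (f i)"
  shows "rational_from m (\<lambda>n. \<Prod>i\<in>I. f i n)"
  using assms
proof (induction I rule: infinite_finite_induct)
  case (insert x F)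
  then show ?case by (simp add: rational_from_mult)
qed (simp_all add: rational_from_const)

lemma rational_from_power [intro]:
  "rational_from m f \<Longrightarrow> rational_from m (\<lambda>n. f n ^ k)"
  by (induction k) (auto simp: rational_from_const rational_from_mult)

text \<open>Gaussian elimination works uniformly in \<open>n\<close>: the strict superharmonic function \<open>h\<close>
  forces every pivot \<open>1 - Q n s s\<close> to be positive, and it stays strictly superharmonic for the
  system with one state eliminated.\<close>

lemma rational_from_linear_system:
  assumes "finite S"
    and "\<And>n s t. n \<ge> m \<Longrightarrow> s \<in> S \<Longrightarrow> t \<in> S \<Longrightarrow> 0 \<le> Q n s t"
    and "\<And>n s. n \<ge> m \<Longrightarrow> s \<in> S \<Longrightarrow> 0 < h n s"
    and "\<And>n s. n \<ge> m \<Longrightarrow> s \<in> S \<Longrightarrow> (\<Sum>t\<in>S. Q n s t * h n t) < h n s"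
    and "\<And>s t. s \<in> S \<Longrightarrow> t \<in> S \<Longrightarrow> rational_from m (\<lambda>n. Q n s t)"
    and "\<And>s. s \<in> S \<Longrightarrow> rational_from m (\<lambda>n. b n s)"
    and "\<And>n s. n \<ge> m \<Longrightarrow> s \<in> S \<Longrightarrow> \<Phi> n s = b n s + (\<Sum>t\<in>S. Q n s t * \<Phi> n t)"
    and "s \<in> S"
  shows "rational_from m (\<lambda>n. \<Phi> n s)"
  using assms
proof (induction S arbitrary: Q b s rule: finite_induct)
  case empty
  then show ?case by simp
next
  case (insert z S)
  note fin = insert.hyps(1) and z = insert.hyps(2) and Qnn = insert.prems(1) and hpos = insert.prems(2)
    and hsup = insert.prems(3) and Qrat = insert.prems(4) and brat = insert.prems(5)
    and sys = insert.prems(6)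
  define c where "c n = 1 - Q n z z" for n
  have hz: "(\<Sum>t\<in>S. Q n z t * h n t) < c n * h n z" if "n \<ge> m" for n
    using hsup[OF that, of z] fin z by (simp add: c_def algebra_simps)
  have cpos: "c n > 0" if "n \<ge> m" for n
  proof -
    have "0 \<le> (\<Sum>t\<in>S. Q n z t * h n t)"
      using that by (intro sum_nonneg mult_nonneg_nonneg Qnn less_imp_le[OF hpos]) auto
    then have "0 < c n * h n z" using hz[OF that] by linarith
    then show ?thesis using hpos[OF that, of z] by (simp add: zero_less_mult_iff)
  qed
  have crat: "rational_from m c"
    unfolding c_def[abs_def] by (intro rational_from_diff rational_from_const Qrat) auto
  \<comment> \<open>The chain watched only outside \<open>z\<close>: a detour through
    \<open>z\<close> may stay there any number of steps, and the geometric series over these stays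
    sums to \<open>1 / c n\<close>.\<close>
  define Q' where "Q' n s t = Q n s t + Q n s z * Q n z t / c n" for n s t
  define b' where "b' n s = b n s + Q n s z * b n z / c n" for n s
  have zeq: "\<Phi> n z = (b n z + (\<Sum>t\<in>S. Q n z t * \<Phi> n t)) / c n" if "n \<ge> m" for n
  proof -
    have "c n * \<Phi> n z = b n z + (\<Sum>t\<in>S. Q n z t * \<Phi> n t)"
      using sys[OF that, of z] fin z by (simp add: c_def algebra_simps)
    then show ?thesis using cpos[OF that] by (simp add: field_simps)
  qed
  have sum_Q': "(\<Sum>t\<in>S. Q' n s t * g t) = (\<Sum>t\<in>S. Q n s t * g t) + Q n s z * (\<Sum>t\<in>S. Q n z t * g t) / c n"
    for n s and g :: "'a \<Rightarrow> real"
    unfolding Q'_def by (simp add: algebra_simps sum.distrib sum_distrib_left sum_divide_distrib)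
  have IH: "rational_from m (\<lambda>n. \<Phi> n s)" if "s \<in> S" for s
  proof (rule insert.IH[of Q' b'])
    show "0 \<le> Q' n s t" if "n \<ge> m" "s \<in> S" "t \<in> S" for n s t
      unfolding Q'_def using that cpos[of n]
      by (intro add_nonneg_nonneg divide_nonneg_pos mult_nonneg_nonneg Qnn) auto
    show "0 < h n s" if "n \<ge> m" "s \<in> S" for n s using hpos that by auto
    show "(\<Sum>t\<in>S. Q' n s t * h n t) < h n s" if "n \<ge> m" "s \<in> S" for n s
    proof -
      have "Q n s z * ((\<Sum>t\<in>S. Q n z t * h n t) / c n) \<le> Q n s z * h n z"
        using hz[OF that(1)] cpos[OF that(1)] that
        by (intro mult_left_mono Qnn) (auto simp: field_simps)
      then show ?thesis
        unfolding sum_Q' using hsup[OF that(1), of s] that fin z by simp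
    qed
    show "rational_from m (\<lambda>n. Q' n s t)" if "s \<in> S" "t \<in> S" for s t
      unfolding Q'_def using that cpos
      by (intro rational_from_add rational_from_divide rational_from_mult Qrat crat) (auto simp: less_le)
    show "rational_from m (\<lambda>n. b' n s)" if "s \<in> S" for s
      unfolding b'_def using that cpos
      by (intro rational_from_add rational_from_divide rational_from_mult Qrat crat brat) (auto simp: less_le)
    show "\<Phi> n s = b' n s + (\<Sum>t\<in>S. Q' n s t * \<Phi> n t)" if "n \<ge> m" "s \<in> S" for n s
    proof -
      have "\<Phi> n s = b n s + (Q n s z * \<Phi> n z + (\<Sum>t\<in>S. Q n s t * \<Phi> n t))"
        using sys[OF that(1), of s] that fin z by simp
      then show ?thesis
        unfolding sum_Q' b'_def zeq[OF that(1)] by (simp add: algebra_simps add_divide_distrib)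
    qed
  qed (use that in auto)
  show ?case
  proof (cases "s = z")
    case True
    have "rational_from m (\<lambda>n. (b n z + (\<Sum>t\<in>S. Q n z t * \<Phi> n t)) / c n)"
      using cpos
      by (intro rational_from_divide rational_from_add rational_from_sum rational_from_mult Qrat brat crat IH)
        (auto simp: less_le)
    then show ?thesis unfolding True by (rule rational_from_cong) (rule zeq)
  next
    case False
    then show ?thesis using IH insert.prems(7) by auto
  qed
qed

section \<open>Power-weighted tail sums of a killed chain\<close>

lemma summable_power_mult_geometric:
  fixes a :: "nat \<Rightarrow> real"
  assumes "\<And>t. \<bar>a t\<bar> \<le> C * r ^ t" "0 \<le> r" "r < 1"
  shows "summable (\<lambda>t. real t ^ i * a t)"
proof -
  \<comment> \<open>Widening the rate from r to \<rho> leaves room to absorb the polynomial factor.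
    The rate 0 is treated apart because the asymptotic comparison needs a positive base.\<close>
  obtain \<rho> where \<rho>: "r < \<rho>" "\<rho> < 1" using dense[OF assms(3)] by blast
  have "summable (\<lambda>t. real t ^ i * r ^ t)"
  proof (cases "r = 0")
    case True
    then show ?thesis by (intro summable_finite[of "{0}"]) auto
  next
    case False
    then have r: "0 < r" using assms(2) by simp
    show ?thesis
    proof (rule summable_comparison_test_bigo[of "\<lambda>t. \<rho> ^ t"])
      show "summable (\<lambda>t. norm (\<rho> ^ t))" using \<rho> assms(2) by (simp add: summable_geometric)
      show "(\<lambda>t. real t ^ i * r ^ t) \<in> O(\<lambda>t. \<rho> ^ t)"
        using r \<rho> by real_asymp
    qed
  qed
  then have "summable (\<lambda>t. C * (real t ^ i * r ^ t))" by (rule summable_mult)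
  then show ?thesis
    by (rule summable_comparison_test'[where N = 0])
      (use assms(1) in \<open>auto simp: abs_mult mult.left_commute[of C] intro!: mult_left_mono\<close>)
qed

text \<open>Shifting the summation index by one step of the chain and expanding (k + 1)^i expresses
  the i-th sum through all sums of order at most i. The term of top order gives a linear system with
  matrix 1 - Q; the lower orders form the inhomogeneity, known by induction on i. The sum of order 0
  is the expected lifetime of the chain: it exceeds its own average after one step by 1, so it is
  the strictly superharmonic function that elimination requires.\<close>

lemma rational_from_tail_moments:
  fixes \<alpha> :: "nat \<Rightarrow> nat \<Rightarrow> 's \<Rightarrow> real"
  assumes fin: "finite S"
    and Qnn: "\<And>n s t. n \<ge> m \<Longrightarrow> s \<in> S \<Longrightarrow> t \<in> S \<Longrightarrow> 0 \<le> Q n s t"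
    and Qrat: "\<And>s t. s \<in> S \<Longrightarrow> t \<in> S \<Longrightarrow> rational_from m (\<lambda>n. Q n s t)"
    and \<alpha>0: "\<And>n s. n \<ge> m \<Longrightarrow> s \<in> S \<Longrightarrow> \<alpha> 0 n s = 1"
    and \<alpha>Suc: "\<And>n k s. n \<ge> m \<Longrightarrow> s \<in> S \<Longrightarrow> \<alpha> (Suc k) n s = (\<Sum>t\<in>S. Q n s t * \<alpha> k n t)"
    and bound: "\<And>n. n \<ge> m \<Longrightarrow> \<exists>C r. 0 \<le> r \<and> r < 1 \<and> (\<forall>k. \<forall>s\<in>S. \<bar>\<alpha> k n s\<bar> \<le> C * r ^ k)"
    and s: "s \<in> S"
  shows "rational_from m (\<lambda>n. \<Sum>k. real k ^ i * \<alpha> k n s)"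
proof -
  define U where "U i n s = (\<Sum>k. real k ^ i * \<alpha> k n s)" for i n s
  have summ: "summable (\<lambda>k. real k ^ i * \<alpha> k n s)" if "n \<ge> m" "s \<in> S" for i n s
    using bound[OF that(1)] that(2) summable_power_mult_geometric by meson
  have \<alpha>nn: "0 \<le> \<alpha> k n s" if "n \<ge> m" "s \<in> S" for k n s
    using that by (induction k arbitrary: s) (auto simp: \<alpha>0 \<alpha>Suc intro!: sum_nonneg mult_nonneg_nonneg Qnn)
  have shift: "(\<Sum>k. real (Suc k) ^ i * \<alpha> (Suc k) n s) = (\<Sum>t\<in>S. Q n s t * (\<Sum>l\<le>i. real (i choose l) * U l n t))"
    if "n \<ge> m" "s \<in> S" for i n s
  proof -
    have "(\<lambda>k. \<Sum>t\<in>S. Q n s t * (\<Sum>l\<le>i. real (i choose l) * (real k ^ l * \<alpha> k n t)))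
       sums (\<Sum>t\<in>S. Q n s t * (\<Sum>l\<le>i. real (i choose l) * U l n t))"
      unfolding U_def using that summ by (intro sums_sum sums_mult summable_sums) auto
    moreover have "(\<Sum>t\<in>S. Q n s t * (\<Sum>l\<le>i. real (i choose l) * (real k ^ l * \<alpha> k n t)))
        = real (Suc k) ^ i * \<alpha> (Suc k) n s" for k
    proof -
      have pow: "real (Suc k) ^ i = (\<Sum>l\<le>i. real (i choose l) * real k ^ l)"
        using binomial_ring[of "real k" 1 i] by (simp add: add.commute)
      have "(\<Sum>l\<le>i. real (i choose l) * (real k ^ l * \<alpha> k n t)) = real (Suc k) ^ i * \<alpha> k n t" for t
        unfolding pow sum_distrib_right by (simp add: mult.assoc)
      then show ?thesis
        unfolding \<alpha>Suc[OF that] by (simp add: sum_distrib_left mult_ac del: of_nat_Suc)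
    qed
    ultimately show ?thesis by (simp add: sums_iff)
  qed
  have U_eq: "U i n s = (if i = 0 then 1 else 0) + (\<Sum>t\<in>S. Q n s t * (\<Sum>l\<le>i. real (i choose l) * U l n t))"
    if "n \<ge> m" "s \<in> S" for i n s
  proof -
    \<comment> \<open>The head term carries \<open>0 ^ i\<close>, which is 1 exactly for i = 0;
      hence the case distinction in \<open>U_eq\<close>.\<close>
    have "U i n s = (\<Sum>k. real (Suc k) ^ i * \<alpha> (Suc k) n s) + real 0 ^ i * \<alpha> 0 n s"
      unfolding U_def using suminf_split_head[OF summ[OF that], of i] by simp
    then show ?thesis unfolding shift[OF that] by (simp add: \<alpha>0[OF that])
  qed
  have "rational_from m (\<lambda>n. U i n s)" if "s \<in> S" for s
    using that
  proof (induction i arbitrary: s rule: less_induct)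
    case (less i)
    have split: "(\<Sum>l\<le>i. real (i choose l) * U l n t) = U i n t + (\<Sum>l<i. real (i choose l) * U l n t)" for n t
      by (simp add: lessThan_Suc_atMost[symmetric])
    show ?case
    proof (rule rational_from_linear_system[where S = S and Q = Q and h = "U 0"
          and b = "\<lambda>n s. (if i = 0 then 1 else 0) + (\<Sum>t\<in>S. Q n s t * (\<Sum>l<i. real (i choose l) * U l n t))"])
      have U0: "U 0 n s = 1 + (\<Sum>t\<in>S. Q n s t * U 0 n t)" if "n \<ge> m" "s \<in> S" for n s
        using U_eq[OF that, of 0] by simp
      have "0 \<le> U 0 n s" if "n \<ge> m" "s \<in> S" for n s
        unfolding U_def using summ[OF that, of 0] \<alpha>nn[OF that] by (intro suminf_nonneg) auto
      then have "0 \<le> (\<Sum>t\<in>S. Q n s t * U 0 n t)" if "n \<ge> m" "s \<in> S" for n s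
        using that by (intro sum_nonneg mult_nonneg_nonneg Qnn) auto
      then show "0 < U 0 n s" "(\<Sum>t\<in>S. Q n s t * U 0 n t) < U 0 n s" if "n \<ge> m" "s \<in> S" for n s
        using U0[OF that] that by (auto simp: add_pos_nonneg)
      show "rational_from m (\<lambda>n. (if i = 0 then 1 else 0) + (\<Sum>t\<in>S. Q n s t * (\<Sum>l<i. real (i choose l) * U l n t)))"
        if "s \<in> S" for s
        using that less.IH
        by (intro rational_from_add rational_from_const rational_from_sum rational_from_mult Qrat) auto
      show "U i n s = (if i = 0 then 1 else 0) + (\<Sum>t\<in>S. Q n s t * (\<Sum>l<i. real (i choose l) * U l n t))
          + (\<Sum>t\<in>S. Q n s t * U i n t)" if "n \<ge> m" "s \<in> S" for n s
        by (subst U_eq[OF that]) (simp add: split distrib_left sum.distrib)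
    qed (use fin less.prems Qnn Qrat in auto)
  qed
  then show ?thesis unfolding U_def using s by blast
qed

section \<open>Moment and cumulant generating functions\<close>

text \<open>For a mass function p on the naturals this is the k-th derivative of its moment
  generating function; at t = 0 it is the k-th moment.\<close>

definition exp_moment :: "(nat \<Rightarrow> real) \<Rightarrow> nat \<Rightarrow> real \<Rightarrow> real" where
  "exp_moment p k t = (\<Sum>s. real s ^ k * p s * exp (t * real s))"

lemma exp_less_inverse:
  assumes "0 < r" "r < 1" "\<bar>t\<bar> < - ln r"
  shows "exp t * r < (1::real)"
proof -
  have "exp t < exp (- ln r)" using assms by simp
  then show ?thesis using assms by (simp add: exp_minus field_simps)
qed

lemma summable_exp_moment:
  assumes p: "\<And>s. \<bar>p s\<bar> \<le> C * r ^ s" and r: "0 < r" "r < 1" and t: "\<bar>t\<bar> < - ln r"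
  shows "summable (\<lambda>s. real s ^ k * p s * exp (t * real s))"
proof -
  have "summable (\<lambda>s. real s ^ k * (p s * exp (t * real s)))"
  proof (rule summable_power_mult_geometric)
    show "\<bar>p s * exp (t * real s)\<bar> \<le> C * (exp t * r) ^ s" for s
      using mult_right_mono[OF p, of "exp (t * real s)" s]
      by (simp add: abs_mult power_mult_distrib exp_of_nat_mult[symmetric] mult_ac)
    show "exp t * r < 1" using exp_less_inverse[OF r t] .
  qed (use r in simp)
  then show ?thesis by (simp add: mult.assoc)
qed

text \<open>Since exp (t s) = (exp t)^s, the series is a power series in exp t and may be
  differentiated termwise. The auxiliary \<open>u\<close> supplies convergence at a point strictly
  beyond exp t. The factor exp t from the chain rule restores the exponent lowered by
  differentiation, so the net effect is one more factor s.\<close>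

lemma exp_moment_deriv:
  assumes p: "\<And>s. \<bar>p s\<bar> \<le> C * r ^ s" and r: "0 < r" "r < 1" and t: "\<bar>t\<bar> < - ln r"
  shows "(exp_moment p k has_real_derivative exp_moment p (Suc k) t) (at t)"
proof -
  define c where "c s = real s ^ k * p s" for s
  obtain u where u: "\<bar>t\<bar> < u" "u < - ln r" using dense[OF t] by blast
  have exp_pow: "exp (v * real s) = exp v ^ s" for v :: real and s
    by (simp add: exp_of_nat_mult[symmetric] mult.commute)
  have em: "exp_moment p k v = (\<Sum>s. c s * exp v ^ s)" for v
    unfolding exp_moment_def c_def exp_pow by simp
  have "summable (\<lambda>s. c s * exp u ^ s)"
    using summable_exp_moment[OF p r, of u k] u by (simp add: c_def exp_pow)
  then have "DERIV (\<lambda>x. \<Sum>s. c s * x ^ s) (exp t) :> (\<Sum>s. diffs c s * exp t ^ s)"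
    by (rule termdiffs_strong) (use u in simp)
  from DERIV_chain2[OF this DERIV_exp]
  have D: "(exp_moment p k has_real_derivative (\<Sum>s. diffs c s * exp t ^ s) * exp t) (at t)"
    unfolding em[abs_def] .
  have summ: "summable (\<lambda>s. real s ^ Suc k * p s * exp t ^ s)"
    using summable_exp_moment[OF p r t, of "Suc k"] by (simp add: exp_pow)
  have "(\<Sum>s. diffs c s * exp t ^ s) * exp t = (\<Sum>s. diffs c s * exp t ^ s * exp t)"
    using \<open>summable (\<lambda>s. c s * exp u ^ s)\<close> u
    by (intro suminf_mult2 termdiff_converges[where K = "exp u"])
      (auto intro: powser_inside)
  also have "\<dots> = (\<Sum>s. real (Suc s) ^ Suc k * p (Suc s) * exp t ^ Suc s)"
    by (simp add: diffs_def c_def mult_ac del: of_nat_Suc)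
  also have "\<dots> = exp_moment p (Suc k) t"
    unfolding exp_moment_def exp_pow using suminf_split_head[OF summ] by simp
  finally show ?thesis using D by simp
qed

text \<open>This algebra is closed under differentiation near \<open>0\<close> and contains the first derivative of the
  cumulant generating function.\<close>

inductive mgf_algebra :: "(nat \<Rightarrow> nat \<Rightarrow> real) \<Rightarrow> (nat \<Rightarrow> real \<Rightarrow> real) \<Rightarrow> bool"
  for p :: "nat \<Rightarrow> nat \<Rightarrow> real" where
  gen: "mgf_algebra p (\<lambda>n. exp_moment (p n) k)"
| inv: "mgf_algebra p (\<lambda>n t. 1 / exp_moment (p n) 0 t)"
| const: "mgf_algebra p (\<lambda>n t. c)"
| add: "mgf_algebra p \<phi> \<Longrightarrow> mgf_algebra p \<psi> \<Longrightarrow> mgf_algebra p (\<lambda>n t. \<phi> n t + \<psi> n t)"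
| mult: "mgf_algebra p \<phi> \<Longrightarrow> mgf_algebra p \<psi> \<Longrightarrow> mgf_algebra p (\<lambda>n t. \<phi> n t * \<psi> n t)"

lemma exp_moment_pos:
  assumes p: "\<And>s. \<bar>p s\<bar> \<le> C * r ^ s" and r: "0 < r" "r < 1" and t: "\<bar>t\<bar> < - ln r"
    and nn: "\<And>s. 0 \<le> p s" and one: "p sums 1"
  shows "0 < exp_moment p 0 t"
proof -
  have "\<exists>s. p s > 0"
  proof (rule ccontr)
    assume "\<not> ?thesis"
    then have "p = (\<lambda>s. 0)" using nn by (auto simp: less_le)
    then show False using one sums_unique2[OF one] sums_zero by fastforce
  qed
  then obtain s where "p s > 0" by blast
  then show ?thesis
    unfolding exp_moment_def
    using summable_exp_moment[OF p r t, of 0] nn by (intro suminf_pos2[where i = s]) auto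
qed

text \<open>At t = 0 the generators of the algebra become moments and the reciprocal becomes 1,
  because the masses sum to 1. So each member is there a polynomial in the moments, with
  coefficients independent of n. The logarithm is differentiated once before the algebra takes over,
  which is why the order is \<open>Suc i\<close>.\<close>

lemma rational_from_cumulant:
  fixes p :: "nat \<Rightarrow> nat \<Rightarrow> real"
  assumes p: "\<And>n s. n \<ge> m \<Longrightarrow> \<bar>p n s\<bar> \<le> C n * r n ^ s"
    and r: "\<And>n. n \<ge> m \<Longrightarrow> 0 < r n" "\<And>n. n \<ge> m \<Longrightarrow> r n < 1"
    and nn: "\<And>n s. n \<ge> m \<Longrightarrow> 0 \<le> p n s" and one: "\<And>n. n \<ge> m \<Longrightarrow> p n sums 1"
    and mom: "\<And>k. rational_from m (\<lambda>n. \<Sum>s. real s ^ k * p n s)"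
    and K: "\<And>n t. n \<ge> m \<Longrightarrow> \<bar>t\<bar> < - ln (r n) \<Longrightarrow> K n t = ln (exp_moment (p n) 0 t)"
  shows "rational_from m (\<lambda>n. (deriv ^^ Suc i) (K n) 0)"
proof -
  note dE = exp_moment_deriv[OF p r] and posE = exp_moment_pos[OF p r _ nn one]
  have at0: "rational_from m (\<lambda>n. \<phi> n 0)" if "mgf_algebra p \<phi>" for \<phi>
    using that
  proof induction
    case (gen k)
    then show ?case using mom by (simp add: exp_moment_def)
  next
    case inv
    have "exp_moment (p n) 0 0 = 1" if "n \<ge> m" for n
      using one[OF that] by (simp add: exp_moment_def sums_iff)
    then show ?case
      by (intro rational_from_cong[OF rational_from_const[of m 1]]) simp
  qed auto
  have closed: "\<exists>\<psi>. mgf_algebra p \<psi> \<and>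
      (\<forall>n\<ge>m. \<forall>t. \<bar>t\<bar> < - ln (r n) \<longrightarrow> (\<phi> n has_real_derivative \<psi> n t) (at t))"
    if "mgf_algebra p \<phi>" for \<phi>
    using that
  proof induction
    case (gen k)
    show ?case using mgf_algebra.gen[of p "Suc k"] dE by blast
  next
    case inv
    let ?\<psi> = "\<lambda>n t. (- 1) * (exp_moment (p n) 1 t * (1 / exp_moment (p n) 0 t * (1 / exp_moment (p n) 0 t)))"
    have "mgf_algebra p ?\<psi>" by (intro mgf_algebra.intros)
    moreover have "((\<lambda>t. 1 / exp_moment (p n) 0 t) has_real_derivative ?\<psi> n t) (at t)"
      if "n \<ge> m" "\<bar>t\<bar> < - ln (r n)" for n t
      using posE[OF that(1) that(1) that(1) that(2) that(1) that(1)]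
      by (auto intro!: derivative_eq_intros dE[OF that(1) that(1) that(1) that(2)] simp: power2_eq_square)
    ultimately show ?case by blast
  next
    case (const c)
    show ?case using mgf_algebra.const[of p 0] by auto
  next
    case (add \<phi> \<psi>)
    then obtain \<phi>' \<psi>' where "mgf_algebra p \<phi>'" "mgf_algebra p \<psi>'"
      "\<And>n t. n \<ge> m \<Longrightarrow> \<bar>t\<bar> < - ln (r n) \<Longrightarrow> (\<phi> n has_real_derivative \<phi>' n t) (at t)"
      "\<And>n t. n \<ge> m \<Longrightarrow> \<bar>t\<bar> < - ln (r n) \<Longrightarrow> (\<psi> n has_real_derivative \<psi>' n t) (at t)"
      by blast
    then show ?case
      by (intro exI[of _ "\<lambda>n t. \<phi>' n t + \<psi>' n t"]) (auto intro!: mgf_algebra.add DERIV_add)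
  next
    case (mult \<phi> \<psi>)
    then obtain \<phi>' \<psi>' where *: "mgf_algebra p \<phi>'" "mgf_algebra p \<psi>'"
      "\<And>n t. n \<ge> m \<Longrightarrow> \<bar>t\<bar> < - ln (r n) \<Longrightarrow> (\<phi> n has_real_derivative \<phi>' n t) (at t)"
      "\<And>n t. n \<ge> m \<Longrightarrow> \<bar>t\<bar> < - ln (r n) \<Longrightarrow> (\<psi> n has_real_derivative \<psi>' n t) (at t)"
      by blast
    have "mgf_algebra p (\<lambda>n t. \<phi>' n t * \<psi> n t + \<psi>' n t * \<phi> n t)"
      using * mult.hyps by (intro mgf_algebra.add mgf_algebra.mult)
    then show ?case using * by (blast intro: DERIV_mult)
  qed
  have "\<exists>\<psi>. mgf_algebra p \<psi> \<and> (\<forall>n\<ge>m. \<forall>t. \<bar>t\<bar> < - ln (r n) \<longrightarrow> (deriv ^^ Suc i) (K n) t = \<psi> n t)" for i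
  proof (induction i)
    case 0
    let ?\<psi> = "\<lambda>n t. exp_moment (p n) 1 t * (1 / exp_moment (p n) 0 t)"
    have "mgf_algebra p ?\<psi>" by (intro mgf_algebra.intros)
    moreover have "deriv (K n) t = ?\<psi> n t" if n: "n \<ge> m" and t: "\<bar>t\<bar> < - ln (r n)" for n t
    proof -
      have "((\<lambda>t. ln (exp_moment (p n) 0 t)) has_real_derivative ?\<psi> n t) (at t)"
        using posE[OF n n n t n n] dE[OF n n n t, of 0] by (auto intro!: derivative_eq_intros)
      then have "(K n has_real_derivative ?\<psi> n t) (at t)"
        by (rule has_field_derivative_transform_within_open[where S = "{- (- ln (r n))<..<- ln (r n)}"])
          (use K[OF n] t in auto)
      then show ?thesis by (rule DERIV_imp_deriv)
    qed
    ultimately show ?case by (intro exI[of _ ?\<psi>]) simp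
  next
    case (Suc i)
    then obtain \<phi> where \<phi>: "mgf_algebra p \<phi>"
      "\<And>n t. n \<ge> m \<Longrightarrow> \<bar>t\<bar> < - ln (r n) \<Longrightarrow> (deriv ^^ Suc i) (K n) t = \<phi> n t" by blast
    obtain \<psi> where \<psi>: "mgf_algebra p \<psi>"
      "\<And>n t. n \<ge> m \<Longrightarrow> \<bar>t\<bar> < - ln (r n) \<Longrightarrow> (\<phi> n has_real_derivative \<psi> n t) (at t)"
      using closed[OF \<phi>(1)] by blast
    have "deriv ((deriv ^^ Suc i) (K n)) t = \<psi> n t" if n: "n \<ge> m" and t: "\<bar>t\<bar> < - ln (r n)" for n t
      by (rule DERIV_imp_deriv,
          rule has_field_derivative_transform_within_open[OF \<psi>(2)[OF n t], where S = "{- (- ln (r n))<..<- ln (r n)}"])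
        (use \<phi>(2)[OF n] t in auto)
    then show ?case using \<psi>(1) by (intro exI[of _ \<psi>]) simp
  qed
  then obtain \<psi> where \<psi>: "mgf_algebra p \<psi>"
    "\<And>n t. n \<ge> m \<Longrightarrow> \<bar>t\<bar> < - ln (r n) \<Longrightarrow> (deriv ^^ Suc i) (K n) t = \<psi> n t" by blast
  show ?thesis
    by (rule rational_from_cong[OF at0[OF \<psi>(1)]]) (use \<psi>(2)[of _ 0] r in auto)
qed

text \<open>The law of \<open>N\<close> has its point masses as density with respect to counting
  measure, which turns the integral into a series.\<close>

lemma integral_nat_valued:
  fixes N :: "'w \<Rightarrow> nat" and g :: "nat \<Rightarrow> real"
  assumes "prob_space M" and N: "N \<in> measurable M (count_space UNIV)"
    and summ: "summable (\<lambda>s. \<bar>g s\<bar> * measure M {\<omega> \<in> space M. N \<omega> = s})"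
  shows "integrable M (\<lambda>\<omega>. g (N \<omega>))"
    and "(\<integral>\<omega>. g (N \<omega>) \<partial>M) = (\<Sum>s. g s * measure M {\<omega> \<in> space M. N \<omega> = s})"
proof -
  interpret prob_space M by fact
  define p where "p s = measure M {\<omega> \<in> space M. N \<omega> = s}" for s
  have "distr M (count_space UNIV) N = density (count_space UNIV) (\<lambda>s. ennreal (p s))"
  proof (rule measure_eqI_countable)
    fix s :: nat
    have "N -` {s} \<inter> space M = {\<omega> \<in> space M. N \<omega> = s}" by auto
    then show "emeasure (distr M (count_space UNIV) N) {s} = emeasure (density (count_space UNIV) (\<lambda>s. ennreal (p s))) {s}"
      using N by (simp add: emeasure_distr emeasure_density p_def emeasure_eq_measure nn_integral_indicator_finite
          flip: nn_integral_count_space_indicator)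
  qed auto
  note D = this
  have nn: "p s \<ge> 0" for s by (simp add: p_def)
  have I: "integrable (count_space UNIV) (\<lambda>s. p s * g s)"
    using summ nn unfolding integrable_count_space_nat_iff by (simp add: abs_mult p_def mult.commute)
  have "integrable (distr M (count_space UNIV) N) g"
    unfolding D using I nn by (subst integrable_density) auto
  then show "integrable M (\<lambda>\<omega>. g (N \<omega>))"
    using N by (subst (asm) integrable_distr_eq) auto
  have "(\<integral>\<omega>. g (N \<omega>) \<partial>M) = integral\<^sup>L (distr M (count_space UNIV) N) g"
    using N by (subst integral_distr) auto
  also have "\<dots> = (\<integral>s. p s * g s \<partial>count_space UNIV)"
    unfolding D using nn by (subst integral_density) auto
  also have "\<dots> = (\<Sum>s. p s * g s)"
    using I by (rule integral_count_space_nat)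
  finally show "(\<integral>\<omega>. g (N \<omega>) \<partial>M) = (\<Sum>s. g s * measure M {\<omega> \<in> space M. N \<omega> = s})"
    by (simp add: p_def mult.commute)
qed

section \<open>Hitting times with geometric tails\<close>

text \<open>The default 0 on paths without a hit matches the value 0 that
  \<open>hitting_time_real\<close> assigns to \<infinity>, so both agree at every point and not just
  almost surely.\<close>

definition first_hit :: "(nat \<Rightarrow> 'w \<Rightarrow> 'v) \<Rightarrow> 'v \<Rightarrow> 'w \<Rightarrow> nat" where
  "first_hit X b \<omega> = (if \<exists>t. X t \<omega> = b then LEAST t. X t \<omega> = b else 0)"

lemma hitting_time_eq:
  "hitting_time X b \<omega> = (if \<exists>t. X t \<omega> = b then enat (LEAST t. X t \<omega> = b) else \<infinity>)"
proof (cases "\<exists>t. X t \<omega> = b")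
  case True
  then have "X (LEAST t. X t \<omega> = b) \<omega> = b" by (rule LeastI_ex)
  then have "(INF t\<in>{t. X t \<omega> = b}. enat t) = enat (LEAST t. X t \<omega> = b)"
    by (intro antisym INF_lower INF_greatest) (auto intro: Least_le)
  then show ?thesis using True by (simp add: hitting_time_def)
next
  case False
  then show ?thesis by (simp add: hitting_time_def top_enat_def)
qed

lemma hitting_time_real_eq: "hitting_time_real X b \<omega> = real (first_hit X b \<omega>)"
  by (simp add: hitting_time_real_def hitting_time_eq first_hit_def)

text \<open>The interface between walk and probability: the tail \<open>a t\<close> is the
  probability that the hitting time exceeds t, and it decays geometrically. The graph and the
  transition law no longer appear. Positivity of \<open>r\<close> serves to divide by it and to take
  its logarithm.\<close>

locale hitting_tail = prob_space M for M :: "'w measure" +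
  fixes X :: "nat \<Rightarrow> 'w \<Rightarrow> 'v" and b :: 'v and a :: "nat \<Rightarrow> real" and C r :: real
  assumes meas: "{\<omega> \<in> space M. X t \<omega> = b} \<in> events"
    and tail: "prob {\<omega> \<in> space M. \<forall>s\<le>t. X s \<omega> \<noteq> b} = a t"
    and bound: "a t \<le> C * r ^ t"
    and r: "0 < r" "r < 1"
begin

definition mass :: "nat \<Rightarrow> real" where
  "mass s = prob {\<omega> \<in> space M. first_hit X b \<omega> = s}"

lemma pred_hit [measurable]: "Measurable.pred M (\<lambda>\<omega>. X t \<omega> = b)"
  using meas[of t] by (simp add: Measurable.pred_def)

lemma first_hit_measurable [measurable]: "first_hit X b \<in> measurable M (count_space UNIV)"
  unfolding first_hit_def[abs_def] by measurable

lemma tail_nonneg: "0 \<le> a t"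
  unfolding tail[symmetric] by (rule measure_nonneg)

lemma never_hit: "prob {\<omega> \<in> space M. \<forall>t. X t \<omega> \<noteq> b} = 0"
proof -
  have "(\<lambda>t. C * r ^ t) \<longlonglongrightarrow> C * 0"
    using r by (intro tendsto_mult_left LIMSEQ_realpow_zero) auto
  moreover have "prob {\<omega> \<in> space M. \<forall>t. X t \<omega> \<noteq> b} \<le> C * r ^ t" for t
  proof -
    have "prob {\<omega> \<in> space M. \<forall>t. X t \<omega> \<noteq> b} \<le> a t"
      unfolding tail[symmetric] by (rule finite_measure_mono) (auto, measurable)
    then show ?thesis using bound[of t] by linarith
  qed
  ultimately have "prob {\<omega> \<in> space M. \<forall>t. X t \<omega> \<noteq> b} \<le> 0"
    by (intro LIMSEQ_le_const) auto
  then show ?thesis using measure_nonneg[of M "{\<omega> \<in> space M. \<forall>t. X t \<omega> \<noteq> b}"] by linarith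
qed

lemma AE_hit: "AE \<omega> in M. hitting_time X b \<omega> < \<infinity>"
proof -
  have "{\<omega> \<in> space M. \<forall>t. X t \<omega> \<noteq> b} \<in> events" by measurable
  then have "AE \<omega> in M. \<exists>t. X t \<omega> = b"
    using never_hit by (intro AE_I[of _ _ "{\<omega> \<in> space M. \<forall>t. X t \<omega> \<noteq> b}"]) (auto simp: emeasure_eq_measure)
  then show ?thesis by eventually_elim (auto simp: hitting_time_eq)
qed

text \<open>Time s itself is included in the avoidance event, so \<open>a s\<close> is the
  probability of a hitting time above s. The mass at 0 is of another kind, because
  \<open>first_hit\<close> is also 0 on paths without a hit.\<close>

lemma mass_Suc: "mass (Suc s) = a s - a (Suc s)"
proof -
  have "{\<omega> \<in> space M. first_hit X b \<omega> = Suc s}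
      = {\<omega> \<in> space M. \<forall>t\<le>s. X t \<omega> \<noteq> b} - {\<omega> \<in> space M. \<forall>t\<le>Suc s. X t \<omega> \<noteq> b}"
  proof (intro set_eqI iffI)
    fix \<omega> assume "\<omega> \<in> {\<omega> \<in> space M. first_hit X b \<omega> = Suc s}"
    then have "\<omega> \<in> space M" and hit: "\<exists>t. X t \<omega> = b" and L: "(LEAST t. X t \<omega> = b) = Suc s"
      by (auto simp: first_hit_def split: if_splits)
    moreover have "X (Suc s) \<omega> = b" using LeastI_ex[OF hit] L by simp
    moreover have "X t \<omega> \<noteq> b" if "t \<le> s" for t
      using not_less_Least[of t "\<lambda>t. X t \<omega> = b"] L that by auto
    ultimately show "\<omega> \<in> {\<omega> \<in> space M. \<forall>t\<le>s. X t \<omega> \<noteq> b} - {\<omega> \<in> space M. \<forall>t\<le>Suc s. X t \<omega> \<noteq> b}"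
      by auto
  next
    fix \<omega> assume *: "\<omega> \<in> {\<omega> \<in> space M. \<forall>t\<le>s. X t \<omega> \<noteq> b} - {\<omega> \<in> space M. \<forall>t\<le>Suc s. X t \<omega> \<noteq> b}"
    then have hit: "X (Suc s) \<omega> = b" by (auto simp: le_Suc_eq)
    have "(LEAST t. X t \<omega> = b) = Suc s"
      using * hit by (intro Least_equality) (auto simp: not_less_eq_eq[symmetric])
    then show "\<omega> \<in> {\<omega> \<in> space M. first_hit X b \<omega> = Suc s}"
      using * hit by (auto simp: first_hit_def)
  qed
  moreover have "{\<omega> \<in> space M. \<forall>t\<le>s. X t \<omega> \<noteq> b} \<in> events" for s by measurable
  ultimately show ?thesis
    unfolding mass_def tail[symmetric] by (simp, intro finite_measure_Diff) (blast intro: le_SucI)+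
qed

lemma mass_nonneg: "0 \<le> mass s"
  by (simp add: mass_def)

lemma C_nonneg: "0 \<le> C"
  using tail_nonneg[of 0] bound[of 0] by simp

text \<open>The mass at s is controlled by the tail at s - 1, which costs the factor
  \<open>1 / r\<close>. The summand 1 covers s = 0, where the bound used is that a probability is at
  most 1.\<close>

lemma mass_bound: "\<bar>mass s\<bar> \<le> (C / r + 1) * r ^ s"
proof (cases s)
  case 0
  have "mass s \<le> 1" by (simp add: mass_def)
  then show ?thesis using 0 mass_nonneg[of s] C_nonneg r by (simp add: add_increasing)
next
  case (Suc t)
  have "mass s \<le> C * r ^ t"
    unfolding Suc mass_Suc using bound[of t] tail_nonneg[of "Suc t"] by linarith
  also have "\<dots> = C / r * r ^ s" using r by (simp add: Suc)
  also have "\<dots> \<le> (C / r + 1) * r ^ s" using r by (intro mult_right_mono) auto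
  finally show ?thesis using mass_nonneg[of s] by simp
qed

lemma has_integral_hit:
  assumes "summable (\<lambda>s. \<bar>g s\<bar> * mass s)"
  shows "integrable M (\<lambda>\<omega>. g (first_hit X b \<omega>))"
    and "(\<integral>\<omega>. g (first_hit X b \<omega>) \<partial>M) = (\<Sum>s. g s * mass s)"
  using integral_nat_valued[OF prob_space_axioms first_hit_measurable, of g] assms
  by (auto simp: mass_def)

lemma summable_power_mass: "summable (\<lambda>s. real s ^ i * mass s)"
  using summable_power_mult_geometric[OF mass_bound] r by auto

lemma mass_sums: "mass sums 1"
  using has_integral_hit(2)[of "\<lambda>s. 1"] summable_power_mass[of 0] by (simp add: sums_iff prob_space)

lemma moment_eq: "moment M (hitting_time_real X b) i = (\<Sum>s. real s ^ i * mass s)"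
  unfolding moment_def hitting_time_real_eq
  using has_integral_hit(2)[of "\<lambda>s. real s ^ i"] summable_power_mass[of i] by simp

lemma integrable_power: "integrable M (\<lambda>\<omega>. hitting_time_real X b \<omega> ^ i)"
  unfolding hitting_time_real_eq
  using has_integral_hit(1)[of "\<lambda>s. real s ^ i"] summable_power_mass[of i] by simp

text \<open>Binomial expansion around the mean. The minus sign is written as a factor
  \<open>- 1\<close> so that the closure rules for constants, products and powers apply to the
  right-hand side as it stands.\<close>

lemma central_moment_eq:
  "central_moment M (hitting_time_real X b) i =
    (\<Sum>k\<le>i. real (i choose k) * moment M (hitting_time_real X b) k * (- 1 * moment M (hitting_time_real X b) 1) ^ (i - k))"
proof -
  define c where "c = moment M (hitting_time_real X b) 1"
  have "central_moment M (hitting_time_real X b) i = (\<integral>\<omega>. (hitting_time_real X b \<omega> + (- 1 * c)) ^ i \<partial>M)"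
    by (simp add: central_moment_def c_def moment_def)
  also have "\<dots> = (\<integral>\<omega>. (\<Sum>k\<le>i. real (i choose k) * hitting_time_real X b \<omega> ^ k * (- 1 * c) ^ (i - k)) \<partial>M)"
    by (simp only: binomial_ring)
  also have "\<dots> = (\<Sum>k\<le>i. real (i choose k) * moment M (hitting_time_real X b) k * (- 1 * c) ^ (i - k))"
    unfolding moment_def
    by (subst Bochner_Integration.integral_sum)
      (auto intro!: integrable_mult_left integrable_mult_right integrable_power)
  finally show ?thesis by (simp add: c_def)
qed

lemma mgf:
  assumes "\<bar>t\<bar> < - ln r"
  shows "integrable M (\<lambda>\<omega>. exp (t * hitting_time_real X b \<omega>))"
    and "(\<integral>\<omega>. exp (t * hitting_time_real X b \<omega>) \<partial>M) = exp_moment mass 0 t"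
  using has_integral_hit[of "\<lambda>s. exp (t * real s)"] summable_exp_moment[OF mass_bound r assms, of 0]
  by (simp_all add: hitting_time_real_eq exp_moment_def mult.commute)

lemma has_mgf_hit: "has_mgf M (hitting_time_real X b)"
  unfolding has_mgf_def using mgf(1) r by (intro exI[of _ "- ln r"]) auto

text \<open>Summation by parts: the weight of \<open>a s\<close> becomes (s + 1)^i - s^i, whose
  expansion loses the top binomial term and leaves the orders l < i. The terms at s = 0 drop out
  because i is positive.\<close>

lemma mass_moment_tail:
  assumes "i \<ge> 1"
  shows "(\<Sum>s. real s ^ i * mass s) = (\<Sum>l<i. real (i choose l) * (\<Sum>s. real s ^ l * a s))"
proof -
  have sa: "summable (\<lambda>s. real s ^ l * a s)" for l
    using summable_power_mult_geometric[of a C r l] tail_nonneg bound r by simp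
  have "(\<lambda>s. \<Sum>l\<le>i. real (i choose l) * (real s ^ l * a s)) sums (\<Sum>l\<le>i. real (i choose l) * (\<Sum>s. real s ^ l * a s))"
    by (intro sums_sum sums_mult summable_sums sa)
  moreover have "(\<Sum>l\<le>i. real (i choose l) * (real s ^ l * a s)) = real (Suc s) ^ i * a s" for s
  proof -
    have pow: "real (Suc s) ^ i = (\<Sum>l\<le>i. real (i choose l) * real s ^ l)"
      using binomial_ring[of "real s" 1 i] by (simp add: add.commute)
    show ?thesis unfolding pow sum_distrib_right by (simp add: mult.assoc)
  qed
  ultimately have 1: "(\<lambda>s. real (Suc s) ^ i * a s) sums (\<Sum>l\<le>i. real (i choose l) * (\<Sum>s. real s ^ l * a s))"
    by simp
  have 2: "(\<lambda>s. real (Suc s) ^ i * a (Suc s)) sums (\<Sum>s. real s ^ i * a s)"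
    using sums_split_initial_segment[OF summable_sums[OF sa[of i]], of 1] assms by (simp add: power_0_left)
  have "(\<lambda>s. real (Suc s) ^ i * mass (Suc s)) sums
      ((\<Sum>l\<le>i. real (i choose l) * (\<Sum>s. real s ^ l * a s)) - (\<Sum>s. real s ^ i * a s))"
    using sums_diff[OF 1 2] by (simp add: mass_Suc right_diff_distrib)
  then have "(\<Sum>s. real (Suc s) ^ i * mass (Suc s)) = (\<Sum>l<i. real (i choose l) * (\<Sum>s. real s ^ l * a s))"
    by (simp add: sums_iff lessThan_Suc_atMost[symmetric])
  then show ?thesis
    using suminf_split_head[OF summable_power_mass[of i]] assms by (simp add: power_0_left)
qed

end

lemma rational_from_hitting_time:
  fixes M :: "nat \<Rightarrow> 'w measure"
  assumes tail: "\<And>n. n \<ge> m \<Longrightarrow> hitting_tail (M n) (X n) (b n) (a n) (C n) (r n)"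
    and rat: "\<And>i. rational_from m (\<lambda>n. \<Sum>s. real s ^ i * a n s)"
  shows "rational_from m (\<lambda>n. moment (M n) (hitting_time_real (X n) (b n)) i)"
    and "rational_from m (\<lambda>n. central_moment (M n) (hitting_time_real (X n) (b n)) i)"
    and "i \<ge> 1 \<Longrightarrow> rational_from m (\<lambda>n. cumulant (M n) (hitting_time_real (X n) (b n)) i)"
proof -
  define p where "p n = hitting_tail.mass (M n) (X n) (b n)" for n
  have mass: "rational_from m (\<lambda>n. \<Sum>s. real s ^ i * p n s)" for i
  proof (cases "i = 0")
    case True
    have "(\<Sum>s. real s ^ i * p n s) = 1" if "n \<ge> m" for n
      using hitting_tail.mass_sums[OF tail[OF that]] True by (simp add: p_def sums_iff)
    then show ?thesis by (intro rational_from_cong[OF rational_from_const[of m 1]])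
  next
    case False
    have "rational_from m (\<lambda>n. \<Sum>l<i. real (i choose l) * (\<Sum>s. real s ^ l * a n s))"
      by (intro rational_from_sum rational_from_mult rational_from_const rat)
    then show ?thesis
      by (rule rational_from_cong) (use hitting_tail.mass_moment_tail[OF tail] False in \<open>simp add: p_def\<close>)
  qed
  show mom: "rational_from m (\<lambda>n. moment (M n) (hitting_time_real (X n) (b n)) i)" for i
    by (rule rational_from_cong[OF mass[of i]]) (simp add: hitting_tail.moment_eq[OF tail] p_def)
  show "rational_from m (\<lambda>n. central_moment (M n) (hitting_time_real (X n) (b n)) i)"
    by (rule rational_from_cong[OF _ hitting_tail.central_moment_eq[OF tail]])
      (intro rational_from_sum rational_from_mult rational_from_power rational_from_const mom)
  show "rational_from m (\<lambda>n. cumulant (M n) (hitting_time_real (X n) (b n)) i)" if "i \<ge> 1"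
  proof -
    obtain j where i: "i = Suc j" using \<open>i \<ge> 1\<close> by (cases i) auto
    show ?thesis
      unfolding cumulant_def i
      by (rule rational_from_cumulant[where p = p and r = r and C = "\<lambda>n. C n / r n + 1"])
        (use hitting_tail.mass_bound[OF tail] hitting_tail.r[OF tail] hitting_tail.mass_nonneg[OF tail]
          hitting_tail.mass_sums[OF tail] hitting_tail.mgf(2)[OF tail] mass in \<open>simp_all add: p_def\<close>)
  qed
qed

section \<open>Survival probabilities of the simple random walk\<close>

text \<open>First-step analysis of the walk killed at \<open>b\<close>: the probability, from
  \<open>v\<close>, of avoiding \<open>b\<close> at all times 0 to t. It refers to no probability
  space, so it can be computed on the graph alone; \<open>random_walk_survival\<close> makes the
  link to the process.\<close>

fun survival :: "'v graph \<Rightarrow> 'v \<Rightarrow> nat \<Rightarrow> 'v \<Rightarrow> real" where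
  "survival H b 0 v = (if v = b then 0 else 1)"
| "survival H b (Suc t) v = (if v = b then 0 else \<Sum>u\<in>verts H. step_prob H v u * survival H b t u)"

lemma weight_nonneg: "0 \<le> weight H v u"
  by (simp add: weight_def)

lemma wdegree_nonneg: "0 \<le> wdegree H v"
  unfolding wdegree_def by (intro sum_nonneg weight_nonneg)

lemma step_prob_nonneg: "0 \<le> step_prob H v u"
  using weight_nonneg[of H v u] wdegree_nonneg[of H v] by (simp add: step_prob_def)

lemma edge_verts: "is_graph H \<Longrightarrow> {v, u} \<in> edges H \<Longrightarrow> v \<in> verts H \<and> u \<in> verts H"
  unfolding is_graph_def by (metis insert_subset)

lemma wdegree_pos:
  assumes "is_graph H" "{v, u} \<in> edges H"
  shows "0 < wdegree H v"
  unfolding wdegree_def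
proof (rule sum_pos2)
  show "u \<in> verts H" using edge_verts[OF assms] by blast
qed (use assms weight_nonneg in \<open>auto simp: weight_def is_graph_def\<close>)

lemma step_prob_pos:
  assumes "is_graph H" "{v, u} \<in> edges H"
  shows "0 < step_prob H v u"
  using wdegree_pos[OF assms] assms(2) by (simp add: step_prob_def weight_def)

lemma sum_step_prob:
  assumes "is_graph H" "v \<in> verts H"
  shows "(\<Sum>u\<in>verts H. step_prob H v u) = 1"
proof (cases "wdegree H v = 0")
  case True
  then show ?thesis using assms by (simp add: step_prob_def is_graph_def)
next
  case False
  then show ?thesis
    by (simp add: step_prob_def wdegree_def flip: sum_divide_distrib)
qed

lemma survival_nonneg: "0 \<le> survival H b t v"
  by (induction t arbitrary: v) (simp_all add: sum_nonneg step_prob_nonneg)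

lemma survival_le_1:
  assumes "is_graph H" "v \<in> verts H"
  shows "survival H b t v \<le> 1"
  using assms(2)
proof (induction t arbitrary: v)
  case (Suc t)
  have "(\<Sum>u\<in>verts H. step_prob H v u * survival H b t u) \<le> (\<Sum>u\<in>verts H. step_prob H v u * 1)"
    using Suc.IH by (intro sum_mono mult_left_mono step_prob_nonneg)
  then show ?case using sum_step_prob[OF assms(1) Suc.prems] by simp
qed simp

lemma survival_Suc_le:
  assumes "is_graph H" "v \<in> verts H"
  shows "survival H b (Suc t) v \<le> survival H b t v"
  using assms(2)
proof (induction t arbitrary: v)
  case 0
  then show ?case using survival_le_1[OF assms(1) 0, of b "Suc 0"] by (cases "v = b") auto
next
  case (Suc t)
  then have "v \<noteq> b \<Longrightarrow> ?case"
    by (subst (1 2) survival.simps) (auto intro!: sum_mono mult_left_mono step_prob_nonneg simp del: survival.simps)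
  then show ?case by auto
qed

lemma survival_antimono:
  assumes "is_graph H" "v \<in> verts H" "s \<le> t"
  shows "survival H b t v \<le> survival H b s v"
  by (rule lift_Suc_antimono_le[of "\<lambda>t. survival H b t v", OF survival_Suc_le[OF assms(1,2)] assms(3)])

text \<open>Induction backwards along a path that ends in \<open>b\<close>. Each edge of the path is
  taken with positive probability, so a time that works for the next vertex works for the present
  one after adding 1.\<close>

lemma ex_survival_less_1:
  assumes "is_graph H" "connected_graph H" "b \<in> verts H" "v \<in> verts H"
  shows "\<exists>t. survival H b t v < 1"
proof -
  have "(v, b) \<in> {(a, b). {a, b} \<in> edges H}\<^sup>*"
    using assms unfolding connected_graph_def by blast
  then show ?thesis
  proof (induction rule: converse_rtrancl_induct)
    case base
    show ?case by (intro exI[of _ 0]) simp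
  next
    case (step v u)
    then obtain t where t: "survival H b t u < 1" by blast
    have e: "{v, u} \<in> edges H" using step by simp
    note vu = edge_verts[OF assms(1) e]
    have "(\<Sum>w\<in>verts H. step_prob H v w * survival H b t w) < (\<Sum>w\<in>verts H. step_prob H v w)"
    proof (rule sum_strict_mono_ex1)
      show "\<forall>w\<in>verts H. step_prob H v w * survival H b t w \<le> step_prob H v w"
        using survival_le_1[OF assms(1)] by (auto intro!: mult_left_le step_prob_nonneg)
      show "\<exists>w\<in>verts H. step_prob H v w * survival H b t w < step_prob H v w"
        using vu t step_prob_pos[OF assms(1) e] by (intro bexI[of _ u]) auto
    qed (use assms(1) in \<open>simp add: is_graph_def\<close>)
    then have "survival H b (Suc t) v < 1"
      using sum_step_prob[OF assms(1)] vu by simp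
    then show ?case by blast
  qed
qed

text \<open>The expected hitting time truncated at a large level \<open>L\<close> is a Lyapunov function: one step
  of the killed walk lowers it by \<open>1 - survival H b (Suc L)\<close>, which is positive everywhere.\<close>

lemma survival_geometric:
  assumes H: "is_graph H" "connected_graph H" "b \<in> verts H"
  shows "\<exists>C r. 0 < r \<and> r < 1 \<and> (\<forall>t. \<forall>v\<in>verts H. survival H b t v \<le> C * r ^ t)"
proof -
  have fin: "finite (verts H)" using H(1) by (simp add: is_graph_def)
  obtain T where T: "\<And>v. v \<in> verts H \<Longrightarrow> survival H b (T v) v < 1"
    using ex_survival_less_1[OF H] by metis
  \<comment> \<open>The sum is a convenient common upper bound of all \<open>T v\<close>.\<close>
  define L where "L = (\<Sum>v\<in>verts H. T v)"
  define h where "h v = (\<Sum>t\<le>L. survival H b t v)" for v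
  define \<rho> where "\<rho> v = (\<Sum>u\<in>verts H. step_prob H v u * h u) / h v" for v
  \<comment> \<open>The element 1/2 makes \<open>r\<close> positive and keeps the set nonempty when
    \<open>b\<close> is the only vertex.\<close>
  define r where "r = Max (insert (1/2) (\<rho> ` (verts H - {b})))"
  have h_ge: "1 \<le> h v" if "v \<noteq> b" for v
    unfolding h_def using that survival_nonneg[of H b _ v]
    by (intro order_trans[OF _ member_le_sum[of 0]]) auto
  have \<rho>_less: "\<rho> v < 1" if v: "v \<in> verts H" "v \<noteq> b" for v
  proof -
    have "T v \<le> Suc L"
      unfolding L_def using member_le_sum[of v "verts H" T] v fin by simp
    then have "survival H b (Suc L) v < 1"
      using survival_antimono[OF H(1) v(1)] T[OF v(1)] by (meson order_le_less_trans)
    moreover have "(\<Sum>u\<in>verts H. step_prob H v u * h u) = (\<Sum>t\<le>L. survival H b (Suc t) v)"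
      unfolding h_def sum_distrib_left using v by (subst sum.swap) simp
    moreover have "(\<Sum>t\<le>L. survival H b (Suc t) v) + survival H b 0 v = h v + survival H b (Suc L) v"
      unfolding h_def using sum.atMost_Suc_shift[of "\<lambda>t. survival H b t v" L] by (simp add: add.commute)
    ultimately have "(\<Sum>u\<in>verts H. step_prob H v u * h u) < h v"
      using v by simp
    then show ?thesis using h_ge[OF v(2)] by (simp add: \<rho>_def)
  qed
  have r: "0 < r" "r < 1"
  proof -
    have "1/2 \<le> r" unfolding r_def using fin by (intro Max_ge) auto
    then show "0 < r" by simp
    show "r < 1" unfolding r_def using fin \<rho>_less by (subst Max_less_iff) auto
  qed
  have \<rho>_le: "\<rho> v \<le> r" if "v \<in> verts H" "v \<noteq> b" for v
    unfolding r_def using fin that by (intro Max_ge) auto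
  have bound: "survival H b t v \<le> r ^ t * h v" if "v \<in> verts H" for t v
    using that
  proof (induction t arbitrary: v)
    case 0
    have "0 \<le> h v" unfolding h_def by (intro sum_nonneg survival_nonneg)
    then show ?case using h_ge by (cases "v = b") auto
  next
    case (Suc t)
    show ?case
    proof (cases "v = b")
      case True
      have "0 \<le> h v" unfolding h_def by (intro sum_nonneg survival_nonneg)
      then show ?thesis using True r by simp
    next
      case False
      have "survival H b (Suc t) v \<le> (\<Sum>u\<in>verts H. step_prob H v u * (r ^ t * h u))"
        using False Suc.IH by (auto intro!: sum_mono mult_left_mono step_prob_nonneg)
      also have "\<dots> = r ^ t * (\<Sum>u\<in>verts H. step_prob H v u * h u)"
        by (simp add: sum_distrib_left mult_ac)
      also have "\<dots> = r ^ t * (\<rho> v * h v)"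
        using h_ge[OF False] by (simp add: \<rho>_def)
      also have "\<dots> \<le> r ^ t * (r * h v)"
        using r h_ge[OF False] \<rho>_le[OF Suc.prems False] by (intro mult_left_mono mult_right_mono) auto
      finally show ?thesis by (simp add: mult_ac)
    qed
  qed
  have "survival H b t v \<le> real (Suc L) * r ^ t" if v: "v \<in> verts H" for t v
  proof -
    have "h v \<le> (\<Sum>t\<le>L. 1)" unfolding h_def using survival_le_1[OF H(1) v] by (intro sum_mono)
    then have "r ^ t * h v \<le> r ^ t * real (Suc L)" using r by (intro mult_left_mono) auto
    then show ?thesis using bound[OF v, of t] by (simp add: mult.commute)
  qed
  then show ?thesis using r by blast
qed

section \<open>From the process to the survival recursion\<close>

lemma random_walk_survival:
  assumes H: "is_graph H" and walk: "simple_random_walk M H a X"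
  shows "measure M {\<omega> \<in> space M. \<forall>s\<le>t. X s \<omega> \<noteq> b} = survival H b t a"
    and "{\<omega> \<in> space M. X t \<omega> = b} \<in> sets M"
proof -
  interpret prob_space M using walk by (simp add: simple_random_walk_def)
  have fin: "finite (verts H)" using H by (simp add: is_graph_def)
  have X: "X t \<in> measurable M (count_space (verts H))" for t
    using walk by (simp add: simple_random_walk_def)
  have ev: "{\<omega> \<in> space M. X t \<omega> = c} \<in> events" for t c
  proof -
    have "X t -` ({c} \<inter> verts H) \<inter> space M \<in> events"
      by (rule measurable_sets[OF X]) auto
    also have "X t -` ({c} \<inter> verts H) \<inter> space M = {\<omega> \<in> space M. X t \<omega> = c}"
      using measurable_space[OF X] by auto
    finally show ?thesis .
  qed
  then show "{\<omega> \<in> space M. X t \<omega> = b} \<in> events" .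
  have [measurable]: "Measurable.pred M (\<lambda>\<omega>. X t \<omega> = c)" for t c
    using ev by (simp add: Measurable.pred_def)
  define hist where "hist t w = {\<omega> \<in> space M. \<forall>s\<le>t. X s \<omega> = w s}" for t and w :: "nat \<Rightarrow> 'a"
  have hist_ev: "hist t w \<in> events" for t w
    unfolding hist_def by measurable
  define paths where "paths t = PiE {..t} (\<lambda>_. verts H - {b})" for t :: nat
  have fin_paths: "finite (paths t)" for t
    unfolding paths_def using fin by (intro finite_PiE) auto
  \<comment> \<open>The defining property of the walk speaks only of histories of positive
    probability; for the others both sides are 0.\<close>
  have hist_Suc: "prob (hist (Suc t) (w(Suc t := u))) = prob (hist t w) * step_prob H (w t) u"
    if "u \<in> verts H" for t w u
  proof -
    have eq: "hist (Suc t) (w(Suc t := u)) = {\<omega> \<in> space M. X (Suc t) \<omega> = u \<and> (\<forall>s\<le>t. X s \<omega> = w s)}"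
      unfolding hist_def by (auto simp: le_Suc_eq)
    show ?thesis
    proof (cases "prob (hist t w) > 0")
      case True
      then have "cond_prob M (\<lambda>\<omega>. X (Suc t) \<omega> = u) (\<lambda>\<omega>. \<forall>s\<le>t. X s \<omega> = w s) = step_prob H (w t) u"
        using walk that unfolding simple_random_walk_def hist_def by blast
      then show ?thesis
        unfolding cond_prob_def eq using True by (simp add: hist_def field_simps)
    next
      case False
      then have "prob (hist t w) = 0" using measure_nonneg[of M "hist t w"] by linarith
      moreover have "prob (hist (Suc t) (w(Suc t := u))) \<le> prob (hist t w)"
        by (intro finite_measure_mono hist_ev) (auto simp: eq hist_def)
      ultimately show ?thesis using measure_nonneg[of M "hist (Suc t) (w(Suc t := u))"] by auto
    qed
  qed
  \<comment> \<open>An interpolation: the first t steps are run by the process, along paths avoiding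
    \<open>b\<close>, and the next k steps by the recursion. Handing one step from the recursion to
    the process leaves the value unchanged, so the pure recursion \<open>S 0 k\<close> equals the
    pure avoidance probability \<open>S k 0\<close>.\<close>
  define S where "S t k = (\<Sum>w\<in>paths t. prob (hist t w) * survival H b k (w t))" for t k
  have S_Suc: "S t (Suc k) = S (Suc t) k" for t k
  proof -
    have "S (Suc t) k = (\<Sum>(u, w)\<in>(verts H - {b}) \<times> paths t.
        prob (hist (Suc t) (w(Suc t := u))) * survival H b k u)"
      unfolding S_def paths_def atMost_Suc PiE_insert_eq
      by (subst sum.reindex[OF inj_combinator]) (auto simp: case_prod_unfold)
    also have "\<dots> = (\<Sum>u\<in>verts H - {b}. \<Sum>w\<in>paths t. prob (hist t w) * step_prob H (w t) u * survival H b k u)"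
      unfolding sum.cartesian_product[symmetric] by (intro sum.cong refl) (simp add: hist_Suc)
    also have "\<dots> = (\<Sum>u\<in>verts H. \<Sum>w\<in>paths t. prob (hist t w) * step_prob H (w t) u * survival H b k u)"
    proof (rule sum.mono_neutral_left)
      have "survival H b k b = 0" by (cases k) auto
      then show "\<forall>u\<in>verts H - (verts H - {b}). (\<Sum>w\<in>paths t. prob (hist t w) * step_prob H (w t) u * survival H b k u) = 0"
        by auto
    qed (use fin in auto)
    also have "\<dots> = (\<Sum>w\<in>paths t. \<Sum>u\<in>verts H. prob (hist t w) * step_prob H (w t) u * survival H b k u)"
      by (rule sum.swap)
    also have "\<dots> = S t (Suc k)"
      unfolding S_def by (intro sum.cong refl) (auto simp: sum_distrib_left mult.assoc paths_def)
    finally show ?thesis ..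
  qed
  have S_eq: "S 0 k = S k 0" for k
  proof -
    have "S 0 (j + k) = S j k" for j k
      by (induction j arbitrary: k) (auto simp: S_Suc simp flip: add_Suc_right)
    from this[of k 0] show ?thesis by simp
  qed
  have S_tail: "S t 0 = prob {\<omega> \<in> space M. \<forall>s\<le>t. X s \<omega> \<noteq> b}" for t
  proof -
    have "S t 0 = (\<Sum>w\<in>paths t. prob (hist t w))"
      unfolding S_def paths_def by (intro sum.cong refl) auto
    also have "\<dots> = prob (\<Union>w\<in>paths t. hist t w)"
    proof (rule finite_measure_finite_Union[symmetric, OF fin_paths])
      show "disjoint_family_on (hist t) (paths t)"
        unfolding disjoint_family_on_def
      proof (intro ballI impI)
        fix v w assume vw: "v \<in> paths t" "w \<in> paths t" "v \<noteq> w"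
        then obtain s where "s \<le> t" "v s \<noteq> w s"
          unfolding paths_def by (metis PiE_ext atMost_iff)
        then show "hist t v \<inter> hist t w = {}" unfolding hist_def by auto
      qed
    qed (use hist_ev in auto)
    also have "(\<Union>w\<in>paths t. hist t w) = {\<omega> \<in> space M. \<forall>s\<le>t. X s \<omega> \<noteq> b}"
    proof (intro set_eqI iffI)
      fix \<omega> assume "\<omega> \<in> (\<Union>w\<in>paths t. hist t w)"
      then show "\<omega> \<in> {\<omega> \<in> space M. \<forall>s\<le>t. X s \<omega> \<noteq> b}"
        by (auto simp: paths_def hist_def PiE_iff)
    next
      fix \<omega> assume "\<omega> \<in> {\<omega> \<in> space M. \<forall>s\<le>t. X s \<omega> \<noteq> b}"
      then have "restrict (\<lambda>s. X s \<omega>) {..t} \<in> paths t" "\<omega> \<in> hist t (restrict (\<lambda>s. X s \<omega>) {..t})"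
        using measurable_space[OF X] by (auto simp: paths_def hist_def)
      then show "\<omega> \<in> (\<Union>w\<in>paths t. hist t w)" by blast
    qed
    finally show ?thesis .
  qed
  have start: "AE \<omega> in M. X 0 \<omega> = a" using walk by (simp add: simple_random_walk_def)
  have hist_0: "prob (hist 0 w) = (if w 0 = a then 1 else 0)" for w
  proof (cases "w 0 = a")
    case True
    then have "prob (hist 0 w) = 1"
      using start by (subst prob_eq_1[OF hist_ev]) (auto simp: hist_def)
    then show ?thesis using True by simp
  next
    case False
    then have "prob (hist 0 w) = 0"
      using start by (subst prob_eq_0[OF hist_ev]) (auto simp: hist_def)
    then show ?thesis using False by simp
  qed
  \<comment> \<open>Almost surely \<open>X 0\<close> equals \<open>a\<close> and also lies in the
    vertex set, so \<open>a\<close> is a vertex; for a \<noteq> b the one-point path at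
    \<open>a\<close> is then among \<open>paths 0\<close>.\<close>
  have aV: "a \<in> verts H"
  proof -
    from start AE_space have "AE \<omega> in M. a \<in> verts H"
      by eventually_elim (use measurable_space[OF X] in force)
    then show ?thesis by simp
  qed
  have S_0: "S 0 k = survival H b k a" for k
  proof (cases "a = b")
    case True
    have "prob (hist 0 w) = 0" if "w \<in> paths 0" for w
      using that True unfolding hist_0 paths_def by auto
    moreover have "survival H b k a = 0" using True by (cases k) auto
    ultimately show ?thesis by (simp add: S_def)
  next
    case False
    define w\<^sub>0 where "w\<^sub>0 = restrict (\<lambda>_. a) {..0::nat}"
    have "w\<^sub>0 \<in> paths 0"
      unfolding paths_def w\<^sub>0_def by (subst restrict_PiE_iff) (use False aV in simp)
    moreover have "w\<^sub>0 0 = a" by (simp add: w\<^sub>0_def)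
    ultimately have w\<^sub>0: "w\<^sub>0 \<in> paths 0" "w\<^sub>0 0 = a" by blast+
    have "S 0 k = (\<Sum>w\<in>{w\<^sub>0}. prob (hist 0 w) * survival H b k (w 0))"
      unfolding S_def
    proof (rule sum.mono_neutral_right[OF fin_paths])
      have "w = w\<^sub>0" if "w \<in> paths 0" "w 0 = a" for w
        by (rule PiE_ext[OF that(1)[unfolded paths_def] w\<^sub>0(1)[unfolded paths_def]])
          (use that(2) w\<^sub>0(2) in simp)
      then show "\<forall>w\<in>paths 0 - {w\<^sub>0}. prob (hist 0 w) * survival H b k (w 0) = 0"
        by (auto simp: hist_0)
    qed (use w\<^sub>0 in auto)
    then show ?thesis using w\<^sub>0 by (simp add: hist_0)
  qed
  show "prob {\<omega> \<in> space M. \<forall>s\<le>t. X s \<omega> \<noteq> b} = survival H b t a"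
    using S_eq[of t] S_0[of t] S_tail[of t] by simp
qed

section \<open>Counting injections by their trace\<close>

lemma finite_FI_hom: "finite (FI_hom m n)"
  unfolding FI_hom_def by (rule finite_subset[OF _ finite_PiE[of "{1..m}" "\<lambda>_. {1..n}"]]) auto

lemma FI_homD:
  assumes "f \<in> FI_hom m n"
  shows "f \<in> {1..m} \<rightarrow>\<^sub>E {1..n}" "inj_on f {1..m}" "i \<in> {1..m} \<Longrightarrow> f i \<in> {1..n}"
  using assms unfolding FI_hom_def by auto

lemma FI_hom_image: "f \<in> FI_hom m n \<Longrightarrow> f ` {1..m} \<subseteq> {1..n}"
  using FI_homD(3)[of f m n] by blast

lemma FI_hom_mono: "n \<le> n' \<Longrightarrow> FI_hom m n \<subseteq> FI_hom m n'"
  unfolding FI_hom_def by (auto simp: PiE_iff)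

lemma FI_incl_in: "m \<le> n \<Longrightarrow> FI_incl m \<in> FI_hom m n"
  unfolding FI_hom_def FI_incl_def by (auto simp: inj_on_def)

lemma FI_hom_eqI:
  assumes "f \<in> FI_hom m n" "g \<in> FI_hom m n'" "\<And>i. i \<in> {1..m} \<Longrightarrow> f i = g i"
  shows "f = g"
  using FI_homD(1)[OF assms(1)] FI_homD(1)[OF assms(2)] assms(3)
  by (intro extensionalityI[where A = "{1..m}"]) (simp_all add: PiE_def)

lemma compose_FI_hom:
  assumes "f \<in> FI_hom l m" "g \<in> FI_hom m n"
  shows "compose {1..l} g f \<in> FI_hom l n"
proof -
  have "compose {1..l} g f \<in> {1..l} \<rightarrow>\<^sub>E {1..n}"
    using FI_homD(3)[OF assms(1)] FI_homD(3)[OF assms(2)] by (auto simp: compose_def)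
  moreover have "inj_on (compose {1..l} g f) {1..l}"
    using FI_homD[OF assms(1)] FI_homD(2)[OF assms(2)]
    by (intro inj_onI) (simp add: compose_def inj_on_eq_iff)
  ultimately show ?thesis by (simp add: FI_hom_def)
qed

lemma compose_FI_incl:
  assumes "f \<in> FI_hom l m"
  shows "compose {1..l} (FI_incl m) f = f"
proof (rule extensionalityI[where A = "{1..l}"])
  show "f \<in> extensional {1..l}" using FI_homD(1)[OF assms] by (simp add: PiE_def)
  show "compose {1..l} (FI_incl m) f i = f i" if "i \<in> {1..l}" for i
    using that FI_homD(3)[OF assms that] by (simp add: compose_def FI_incl_def)
qed simp

text \<open>Domain and image of the partial injection have complements of equal size in {1..n}; any
  bijection between these complements completes it to a permutation.\<close>

lemma FI_hom_extend:
  assumes "C \<subseteq> {1..n}" "\<psi> ` C \<subseteq> {1..n}" "inj_on \<psi> C"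
  obtains \<pi> where "\<pi> \<in> FI_hom n n" "\<And>c. c \<in> C \<Longrightarrow> \<pi> c = \<psi> c"
proof -
  have "finite C" using assms(1) finite_subset by blast
  then have "card ({1..n} - C) = card ({1..n} - \<psi> ` C)"
    using assms by (simp add: card_Diff_subset card_image)
  then obtain h where h: "bij_betw h ({1..n} - C) ({1..n} - \<psi> ` C)"
    using finite_same_card_bij[of "{1..n} - C" "{1..n} - \<psi> ` C"] by auto
  define \<pi> where "\<pi> = (\<lambda>c\<in>{1..n}. if c \<in> C then \<psi> c else h c)"
  have h_in: "h c \<in> {1..n} - \<psi> ` C" if "c \<in> {1..n} - C" for c
    using bij_betwE[OF h] that by blast
  have "\<pi> \<in> {1..n} \<rightarrow>\<^sub>E {1..n}"
    unfolding \<pi>_def using assms(2)[unfolded image_subset_iff] h_in by (auto simp del: atLeastAtMost_iff)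
  moreover have "inj_on \<pi> {1..n}"
  proof (rule inj_onI)
    fix c c' assume c: "c \<in> {1..n}" "c' \<in> {1..n}" "\<pi> c = \<pi> c'"
    show "c = c'"
    proof (cases "c \<in> C"; cases "c' \<in> C")
      assume "c \<in> C" "c' \<in> C"
      then show ?thesis using c assms(3) by (simp add: \<pi>_def inj_on_eq_iff)
    next
      assume C: "c \<in> C" "c' \<notin> C"
      then show ?thesis using c h_in[of c'] imageI[OF C(1), of \<psi>] by (auto simp: \<pi>_def)
    next
      assume C: "c \<notin> C" "c' \<in> C"
      then show ?thesis using c h_in[of c] imageI[OF C(2), of \<psi>] by (auto simp: \<pi>_def)
    next
      assume "c \<notin> C" "c' \<notin> C"
      then show ?thesis using c bij_betw_imp_inj_on[OF h] by (simp add: \<pi>_def inj_on_eq_iff)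
    qed
  qed
  ultimately have "\<pi> \<in> FI_hom n n" by (simp add: FI_hom_def)
  then show thesis using assms(1) by (intro that[of \<pi>]) (auto simp: \<pi>_def)
qed

section \<open>Invariants of injections under relabelling\<close>

definition overlap :: "nat \<Rightarrow> (nat \<Rightarrow> nat) \<Rightarrow> (nat \<Rightarrow> nat) \<Rightarrow> (nat \<times> nat) set" where
  "overlap d f g = {(i, j). i \<in> {1..d} \<and> j \<in> {1..d} \<and> f i = g j}"

text \<open>The partial injection induced into \<open>B\<close>, stored as a set of pairs. It does
  not mention n, so traces of injections into different {1..n} can be compared.\<close>

definition trace_on :: "nat \<Rightarrow> nat set \<Rightarrow> (nat \<Rightarrow> nat) \<Rightarrow> (nat \<times> nat) set" where
  "trace_on d B f = {(i, b). i \<in> {1..d} \<and> b \<in> B \<and> f i = b}"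

lemma trace_on_eq_iff:
  "trace_on d B f = trace_on d B g \<longleftrightarrow> (\<forall>i\<in>{1..d}. \<forall>b\<in>B. f i = b \<longleftrightarrow> g i = b)"
proof
  assume eq: "trace_on d B f = trace_on d B g"
  have mem: "(i, b) \<in> trace_on d B f \<longleftrightarrow> (i, b) \<in> trace_on d B g" for i b
    using eq by simp
  show "\<forall>i\<in>{1..d}. \<forall>b\<in>B. f i = b \<longleftrightarrow> g i = b"
  proof (intro ballI)
    fix i b assume "i \<in> {1..d}" "b \<in> B"
    then show "f i = b \<longleftrightarrow> g i = b" using mem[of i b] by (simp add: trace_on_def)
  qed
qed (auto simp: trace_on_def)

text \<open>The overlap is a complete invariant of pairs of injections under permutations of {1..n}.
  Equality of overlaps says exactly that sending f to g and f' to g' pointwise is well defined and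
  injective on the union of the two images; a permutation extends it.\<close>

lemma overlap_transport:
  assumes f: "f \<in> FI_hom d n" "f' \<in> FI_hom d n" and g: "g \<in> FI_hom d n" "g' \<in> FI_hom d n"
    and eq: "overlap d f f' = overlap d g g'"
  obtains \<pi> where "\<pi> \<in> FI_hom n n" "compose {1..d} \<pi> f = g" "compose {1..d} \<pi> f' = g'"
proof -
  have ov: "f i = f' j \<longleftrightarrow> g i = g' j" if "i \<in> {1..d}" "j \<in> {1..d}" for i j
    using eq that unfolding overlap_def set_eq_iff by auto
  note inj = FI_homD(2)[OF f(1)] FI_homD(2)[OF f(2)] FI_homD(2)[OF g(1)] FI_homD(2)[OF g(2)]
  define \<psi> where "\<psi> c = (if c \<in> f ` {1..d} then g (inv_into {1..d} f c) else g' (inv_into {1..d} f' c))" for c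
  have \<psi>f: "\<psi> (f i) = g i" if "i \<in> {1..d}" for i
    using that inj(1) by (simp add: \<psi>_def)
  have \<psi>f': "\<psi> (f' j) = g' j" if j: "j \<in> {1..d}" for j
  proof (cases "f' j \<in> f ` {1..d}")
    case True
    then obtain i where i: "i \<in> {1..d}" "f' j = f i" by blast
    then have "g i = g' j" using ov[OF i(1) j] by simp
    then show ?thesis using \<psi>f[OF i(1)] i(2) by simp
  next
    case False
    then show ?thesis using j inj(2) by (simp add: \<psi>_def)
  qed
  have "inj_on \<psi> (f ` {1..d} \<union> f' ` {1..d})"
  proof (rule inj_onI)
    fix c c' assume "c \<in> f ` {1..d} \<union> f' ` {1..d}" "c' \<in> f ` {1..d} \<union> f' ` {1..d}" and e: "\<psi> c = \<psi> c'"
    then consider i i' where "i \<in> {1..d}" "i' \<in> {1..d}" "c = f i" "c' = f i'"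
      | i j where "i \<in> {1..d}" "j \<in> {1..d}" "c = f i" "c' = f' j"
      | i j where "i \<in> {1..d}" "j \<in> {1..d}" "c' = f i" "c = f' j"
      | j j' where "j \<in> {1..d}" "j' \<in> {1..d}" "c = f' j" "c' = f' j'"
      by blast
    then show "c = c'"
    proof cases
      case (1 i i')
      then show ?thesis using e inj(3) by (simp add: \<psi>f inj_on_eq_iff)
    next
      case (2 i j)
      then show ?thesis using e ov by (simp add: \<psi>f \<psi>f')
    next
      case (3 i j)
      then show ?thesis using e ov[of i j] by (simp add: \<psi>f \<psi>f')
    next
      case (4 j j')
      then show ?thesis using e inj(4) by (simp add: \<psi>f' inj_on_eq_iff)
    qed
  qed
  note \<psi>_inj = this
  have im: "f ` {1..d} \<union> f' ` {1..d} \<subseteq> {1..n}"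
    using FI_hom_image[OF f(1)] FI_hom_image[OF f(2)] by blast
  have \<psi>_im: "\<psi> ` (f ` {1..d} \<union> f' ` {1..d}) \<subseteq> {1..n}"
    using FI_homD(3)[OF g(1)] FI_homD(3)[OF g(2)] by (auto simp: \<psi>f \<psi>f' simp del: atLeastAtMost_iff)
  obtain \<pi> where \<pi>: "\<pi> \<in> FI_hom n n" "\<And>c. c \<in> f ` {1..d} \<union> f' ` {1..d} \<Longrightarrow> \<pi> c = \<psi> c"
    by (rule FI_hom_extend[OF im \<psi>_im \<psi>_inj]) (rule that)
  have "compose {1..d} \<pi> f = g"
    by (rule FI_hom_eqI[OF compose_FI_hom[OF f(1) \<pi>(1)] g(1)]) (simp add: compose_def \<pi>(2) \<psi>f)
  moreover have "compose {1..d} \<pi> f' = g'"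
    by (rule FI_hom_eqI[OF compose_FI_hom[OF f(2) \<pi>(1)] g(2)]) (simp add: compose_def \<pi>(2) \<psi>f')
  ultimately show thesis using \<pi>(1) that by blast
qed

text \<open>The same argument with the identity on \<open>A\<close> in place of the second pair:
  equal traces make the two prescriptions compatible and jointly injective. For empty
  \<open>A\<close> any two injections are related in this way.\<close>

lemma trace_transport:
  assumes f: "f \<in> FI_hom d n" and g: "g \<in> FI_hom d n" and A: "A \<subseteq> {1..n}"
    and eq: "trace_on d A f = trace_on d A g"
  obtains \<pi> where "\<pi> \<in> FI_hom n n" "compose {1..d} \<pi> f = g" "\<And>a. a \<in> A \<Longrightarrow> \<pi> a = a"
proof -
  have tr: "f i = a \<longleftrightarrow> g i = a" if "i \<in> {1..d}" "a \<in> A" for i a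
    using eq that unfolding trace_on_eq_iff by blast
  note inj = FI_homD(2)[OF f] FI_homD(2)[OF g]
  define \<psi> where "\<psi> c = (if c \<in> A then c else g (inv_into {1..d} f c))" for c
  have \<psi>f: "\<psi> (f i) = g i" if "i \<in> {1..d}" for i
    using that inj(1) tr[OF that, of "f i"] by (simp add: \<psi>_def)
  have "inj_on \<psi> (A \<union> f ` {1..d})"
  proof (rule inj_onI)
    fix c c' assume "c \<in> A \<union> f ` {1..d}" "c' \<in> A \<union> f ` {1..d}" and e: "\<psi> c = \<psi> c'"
    then consider "c \<in> A" "c' \<in> A" | i where "c \<in> A" "i \<in> {1..d}" "c' = f i"
      | i where "c' \<in> A" "i \<in> {1..d}" "c = f i"
      | i i' where "i \<in> {1..d}" "i' \<in> {1..d}" "c = f i" "c' = f i'"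
      by blast
    then show "c = c'"
    proof cases
      case 1
      then show ?thesis using e by (simp add: \<psi>_def)
    next
      case (2 i)
      then have "g i = c" using e \<psi>f[of i] by (simp add: \<psi>_def)
      then show ?thesis using 2 tr[of i c] by simp
    next
      case (3 i)
      then have "g i = c'" using e \<psi>f[of i] by (simp add: \<psi>_def)
      then show ?thesis using 3 tr[of i c'] by simp
    next
      case (4 i i')
      then show ?thesis using e inj(2) by (simp add: \<psi>f inj_on_eq_iff)
    qed
  qed
  note \<psi>_inj = this
  have im: "A \<union> f ` {1..d} \<subseteq> {1..n}"
    using FI_hom_image[OF f] A by blast
  have \<psi>_im: "\<psi> ` (A \<union> f ` {1..d}) \<subseteq> {1..n}"
  proof
    fix z assume "z \<in> \<psi> ` (A \<union> f ` {1..d})"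
    then consider a where "a \<in> A" "z = \<psi> a" | i where "i \<in> {1..d}" "z = \<psi> (f i)" by blast
    then show "z \<in> {1..n}"
    proof cases
      case 1
      then show ?thesis using A by (auto simp: \<psi>_def)
    next
      case (2 i)
      then show ?thesis using FI_homD(3)[OF g, of i] \<psi>f by metis
    qed
  qed
  obtain \<pi> where \<pi>: "\<pi> \<in> FI_hom n n" "\<And>c. c \<in> A \<union> f ` {1..d} \<Longrightarrow> \<pi> c = \<psi> c"
    by (rule FI_hom_extend[OF im \<psi>_im \<psi>_inj]) (rule that)
  have "compose {1..d} \<pi> f = g"
    by (rule FI_hom_eqI[OF compose_FI_hom[OF f \<pi>(1)] g]) (simp add: compose_def \<pi>(2) \<psi>f)
  moreover have "\<pi> a = a" if "a \<in> A" for a using that \<pi>(2) by (simp add: \<psi>_def)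
  ultimately show thesis using \<pi>(1) that by blast
qed

text \<open>Composition with a permutation that fixes \<open>A\<close> and carries f to g permutes
  the summation range, turns overlaps with f into overlaps with g, and preserves traces on
  \<open>A\<close>. This symmetry is what makes the lumping exact.\<close>

lemma sum_FI_hom_transport:
  fixes \<Psi> :: "(nat \<times> nat) set \<Rightarrow> (nat \<times> nat) set \<Rightarrow> real"
  assumes f: "f \<in> FI_hom d n" and g: "g \<in> FI_hom d n" and A: "A \<subseteq> {1..n}"
    and eq: "trace_on d A f = trace_on d A g"
  shows "(\<Sum>h\<in>FI_hom d n. \<Psi> (overlap d f h) (trace_on d A h)) = (\<Sum>h\<in>FI_hom d n. \<Psi> (overlap d g h) (trace_on d A h))"
proof -
  obtain \<pi> where \<pi>: "\<pi> \<in> FI_hom n n" "compose {1..d} \<pi> f = g" "\<And>a. a \<in> A \<Longrightarrow> \<pi> a = a"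
    by (rule trace_transport[OF assms]) (rule that)
  note inj = FI_homD(2)[OF \<pi>(1)]
  let ?c = "\<lambda>h. compose {1..d} \<pi> h"
  have c_in: "?c h \<in> FI_hom d n" if "h \<in> FI_hom d n" for h
    using compose_FI_hom[OF that \<pi>(1)] .
  have "inj_on ?c (FI_hom d n)"
  proof (rule inj_onI)
    fix h h' assume h: "h \<in> FI_hom d n" "h' \<in> FI_hom d n" "?c h = ?c h'"
    show "h = h'"
    proof (rule FI_hom_eqI[OF h(1,2)])
      fix i assume i: "i \<in> {1..d}"
      then have "\<pi> (h i) = \<pi> (h' i)" using fun_cong[OF h(3), of i] by (simp add: compose_def)
      then show "h i = h' i" using inj FI_homD(3)[OF h(1) i] FI_homD(3)[OF h(2) i] by (simp add: inj_on_eq_iff)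
    qed
  qed
  moreover have "?c ` FI_hom d n = FI_hom d n"
    using c_in by (intro endo_inj_surj[OF finite_FI_hom _ \<open>inj_on ?c (FI_hom d n)\<close>]) blast
  ultimately have "(\<Sum>h\<in>FI_hom d n. \<Psi> (overlap d g h) (trace_on d A h))
      = (\<Sum>h\<in>FI_hom d n. \<Psi> (overlap d g (?c h)) (trace_on d A (?c h)))"
    using sum.reindex[of ?c "FI_hom d n" "\<lambda>h. \<Psi> (overlap d g h) (trace_on d A h)"] by simp
  also have "\<dots> = (\<Sum>h\<in>FI_hom d n. \<Psi> (overlap d f h) (trace_on d A h))"
  proof (rule sum.cong[OF refl])
    fix h assume h: "h \<in> FI_hom d n"
    have "overlap d g (?c h) = overlap d f h"
      unfolding \<pi>(2)[symmetric] overlap_def compose_def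
      using inj FI_homD(3)[OF f] FI_homD(3)[OF h] by (auto simp: inj_on_eq_iff simp del: atLeastAtMost_iff)
    moreover have "\<pi> (h i) = a \<longleftrightarrow> h i = a" if "i \<in> {1..d}" "a \<in> A" for i a
      using inj FI_homD(3)[OF h that(1)] \<pi>(3)[OF that(2)] A that(2) by (metis inj_on_eq_iff subsetD)
    then have "trace_on d A (?c h) = trace_on d A h"
      unfolding trace_on_eq_iff by (simp add: compose_def)
    ultimately show "\<Psi> (overlap d g (?c h)) (trace_on d A (?c h)) = \<Psi> (overlap d f h) (trace_on d A h)" by simp
  qed
  finally show ?thesis ..
qed

text \<open>A falling factorial over the reals. If T is smaller than S, the factor with i = card T
  vanishes, so the formula gives the correct count 0 without truncated subtraction.\<close>

lemma card_injections:
  assumes "finite S" "finite T"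
  shows "real (card {f \<in> S \<rightarrow>\<^sub>E T. inj_on f S}) = (\<Prod>i<card S. real (card T) - real i)"
  using assms
proof (induction S arbitrary: T rule: finite_induct)
  case empty
  have "{f \<in> {} \<rightarrow>\<^sub>E T. inj_on f {}} = {\<lambda>_. undefined}" by auto
  then show ?case by simp
next
  case (insert x S)
  let ?I = "\<lambda>T. {f \<in> S \<rightarrow>\<^sub>E T. inj_on f S}"
  have finI: "finite (?I T)" if "finite T" for T :: "'b set"
    using finite_PiE[of S "\<lambda>_. T"] insert.hyps that by (auto intro: finite_subset[rotated])
  have "card {f \<in> insert x S \<rightarrow>\<^sub>E T. inj_on f (insert x S)}
      = card {(y, g). y \<in> T \<and> g \<in> S \<rightarrow>\<^sub>E (T - {y}) \<and> inj_on g S}"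
    unfolding extensional_funcset_extend_domain_inj_on_eq[OF insert.hyps(2)]
    by (rule card_image[OF extensional_funcset_extend_domain_inj_onI[OF insert.hyps(2)]])
  also have "{(y, g). y \<in> T \<and> g \<in> S \<rightarrow>\<^sub>E (T - {y}) \<and> inj_on g S} = (SIGMA y:T. ?I (T - {y}))" by auto
  also have "card \<dots> = (\<Sum>y\<in>T. card (?I (T - {y})))"
    using insert.prems finI by (intro card_SigmaI) auto
  finally have "real (card {f \<in> insert x S \<rightarrow>\<^sub>E T. inj_on f (insert x S)}) = (\<Sum>y\<in>T. real (card (?I (T - {y}))))"
    by simp
  also have "\<dots> = (\<Sum>y\<in>T. \<Prod>i<card S. real (card T) - real (Suc i))"
  proof (rule sum.cong[OF refl])
    fix y assume y: "y \<in> T"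
    then have cy: "real (card (T - {y})) = real (card T) - 1"
      using card_Suc_Diff1[OF insert.prems y] by linarith
    have "real (card (?I (T - {y}))) = (\<Prod>i<card S. real (card T) - 1 - real i)"
      using insert.IH[of "T - {y}"] insert.prems unfolding cy by simp
    then show "real (card (?I (T - {y}))) = (\<Prod>i<card S. real (card T) - real (Suc i))"
      by (simp add: diff_diff_eq)
  qed
  also have "\<dots> = (\<Prod>i<card (insert x S). real (card T) - real i)"
    using insert.hyps by (simp add: prod.lessThan_Suc_shift del: prod.lessThan_Suc)
  finally show ?case .
qed

text \<open>The trace fixes the values at the positions sent into \<open>B\<close>; the other
  positions form an arbitrary injection into {1..n} - B. The injection f only names a trace and may
  live at another level n', which allows counting at level m the traces seen at level n.\<close>

lemma card_FI_hom_trace: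
  assumes f: "f \<in> FI_hom d n'" and B: "B \<subseteq> {1..n}"
  shows "real (card {g \<in> FI_hom d n. trace_on d B g = trace_on d B f})
    = (\<Prod>i<d - card {i \<in> {1..d}. f i \<in> B}. real n - real (card B) - real i)"
proof -
  define D where "D = {i \<in> {1..d}. f i \<in> B}"
  define J where "J = {h \<in> ({1..d} - D) \<rightarrow>\<^sub>E ({1..n} - B). inj_on h ({1..d} - D)}"
  define K where "K = {g \<in> FI_hom d n. trace_on d B g = trace_on d B f}"
  define ext where "ext h = (\<lambda>i\<in>{1..d}. if i \<in> D then f i else h i)" for h :: "nat \<Rightarrow> nat"
  have tr: "trace_on d B g = trace_on d B f \<longleftrightarrow> (\<forall>i\<in>{1..d}. if i \<in> D then g i = f i else g i \<notin> B)" for g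
  proof -
    have "(\<forall>b\<in>B. x = b \<longleftrightarrow> y = b) \<longleftrightarrow> (if y \<in> B then x = y else x \<notin> B)" for x y :: nat
      by auto
    then show ?thesis unfolding trace_on_eq_iff by (simp add: D_def)
  qed
  have "bij_betw (\<lambda>g. restrict g ({1..d} - D)) K J"
  proof (rule bij_betw_byWitness[where f' = ext])
    show "\<forall>g\<in>K. ext (restrict g ({1..d} - D)) = g"
    proof
      fix g assume g: "g \<in> K"
      show "ext (restrict g ({1..d} - D)) = g"
      proof (rule extensionalityI[where A = "{1..d}"])
        show "g \<in> extensional {1..d}" using g FI_homD(1)[of g d n] by (auto simp: K_def PiE_def)
        show "ext (restrict g ({1..d} - D)) i = g i" if "i \<in> {1..d}" for i
          using g that unfolding K_def ext_def tr by auto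
      qed (simp add: ext_def)
    qed
    show "\<forall>h\<in>J. restrict (ext h) ({1..d} - D) = h"
    proof
      fix h assume "h \<in> J"
      then have "h \<in> extensional ({1..d} - D)" by (simp add: J_def PiE_def)
      then show "restrict (ext h) ({1..d} - D) = h"
        by (intro extensionalityI[where A = "{1..d} - D"]) (auto simp: ext_def)
    qed
    show "(\<lambda>g. restrict g ({1..d} - D)) ` K \<subseteq> J"
    proof
      fix h assume "h \<in> (\<lambda>g. restrict g ({1..d} - D)) ` K"
      then obtain g where g: "g \<in> FI_hom d n" "\<And>i. i \<in> {1..d} - D \<Longrightarrow> g i \<notin> B" "h = restrict g ({1..d} - D)"
        unfolding K_def tr by auto
      then show "h \<in> J"
        using FI_homD(2)[OF g(1)] FI_homD(3)[OF g(1)] unfolding J_def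
        by (auto simp: inj_on_def simp del: atLeastAtMost_iff)
    qed
    show "ext ` J \<subseteq> K"
    proof
      fix g assume "g \<in> ext ` J"
      then obtain h where h: "h \<in> J" "g = ext h" by blast
      have hB: "h i \<in> {1..n} - B" if "i \<in> {1..d}" "i \<notin> D" for i
        using h(1) that unfolding J_def by (auto simp: PiE_iff simp del: atLeastAtMost_iff)
      have "g \<in> {1..d} \<rightarrow>\<^sub>E {1..n}"
        unfolding h(2) ext_def using hB B by (auto simp: D_def)
      moreover have "inj_on g {1..d}"
      proof (rule inj_onI)
        fix i j assume ij: "i \<in> {1..d}" "j \<in> {1..d}" "g i = g j"
        have gB: "g k \<in> B \<longleftrightarrow> k \<in> D" if "k \<in> {1..d}" for k
          using hB[OF that] that unfolding h(2) ext_def D_def by auto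
        then have "i \<in> D \<longleftrightarrow> j \<in> D" using ij by metis
        then show "i = j"
          using ij FI_homD(2)[OF f] h(1) unfolding h(2) ext_def J_def
          by (cases "i \<in> D") (auto simp: inj_on_eq_iff)
      qed
      moreover have "trace_on d B g = trace_on d B f"
        unfolding tr h(2) ext_def using hB by auto
      ultimately show "g \<in> K" by (simp add: K_def FI_hom_def)
    qed
  qed
  then have "card K = card J" by (rule bij_betw_same_card)
  moreover have "card ({1..d} - D) = d - card D"
    by (subst card_Diff_subset) (auto simp: D_def)
  moreover have "real (card ({1..n} - B)) = real n - real (card B)"
    using card_mono[OF _ B] B finite_subset[OF B] by (subst card_Diff_subset) (auto simp: of_nat_diff)
  ultimately show ?thesis
    using card_injections[of "{1..d} - D" "{1..n} - B"] by (simp add: K_def J_def D_def)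
qed

text \<open>With d labels to spare outside \<open>B\<close>, every factor of the falling factorial
  at level m is positive, so each trace seen at any level already occurs at level m.\<close>

lemma trace_on_image_subset:
  assumes "B \<subseteq> {1..m}" "card B + d \<le> m"
  shows "trace_on d B ` FI_hom d n \<subseteq> trace_on d B ` FI_hom d m"
proof
  fix \<rho> assume "\<rho> \<in> trace_on d B ` FI_hom d n"
  then obtain f where f: "f \<in> FI_hom d n" "\<rho> = trace_on d B f" by blast
  have "0 < real (card {g \<in> FI_hom d m. trace_on d B g = trace_on d B f})"
    unfolding card_FI_hom_trace[OF f(1) assms(1)] using assms(2) by (intro prod_pos) auto
  then have "{g \<in> FI_hom d m. trace_on d B g = trace_on d B f} \<noteq> {}"
    by (metis card.empty less_irrefl of_nat_0)
  then show "\<rho> \<in> trace_on d B ` FI_hom d m" using f(2) by (auto simp: image_iff)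
qed

text \<open>Grouping by trace: the set of traces is taken at level m and hence is the same for all
  n, while each multiplicity is a polynomial in n.\<close>

lemma rational_from_sum_FI_hom:
  fixes \<Psi> :: "nat \<Rightarrow> (nat \<times> nat) set \<Rightarrow> real"
  assumes B: "B \<subseteq> {1..m}" "card B + d \<le> m" and \<Psi>: "\<And>\<rho>. rational_from m (\<lambda>n. \<Psi> n \<rho>)"
  shows "rational_from m (\<lambda>n. \<Sum>f\<in>FI_hom d n. \<Psi> n (trace_on d B f))"
proof -
  define R where "R = trace_on d B ` FI_hom d m"
  define N where "N n \<rho> = real (card {g \<in> FI_hom d n. trace_on d B g = \<rho>})" for n \<rho>
  have finR: "finite R" by (simp add: R_def finite_FI_hom)
  have Bn: "B \<subseteq> {1..n}" if "n \<ge> m" for n using B(1) that by auto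
  have sub: "trace_on d B ` FI_hom d n \<subseteq> R" for n
    unfolding R_def by (rule trace_on_image_subset[OF B])
  have "rational_from m (\<lambda>n. N n \<rho>)" if \<rho>: "\<rho> \<in> R" for \<rho>
  proof -
    obtain f where f: "f \<in> FI_hom d m" "\<rho> = trace_on d B f" using \<rho> unfolding R_def by blast
    show ?thesis
    proof (rule rational_from_cong)
      show "rational_from m (\<lambda>n. \<Prod>i<d - card {i \<in> {1..d}. f i \<in> B}. real n - real (card B) - real i)"
        by (intro rational_from_prod rational_from_diff rational_from_of_nat rational_from_const)
    qed (simp add: N_def f(2) card_FI_hom_trace[OF f(1) Bn])
  qed
  then have "rational_from m (\<lambda>n. \<Sum>\<rho>\<in>R. \<Psi> n \<rho> * N n \<rho>)"
    by (intro rational_from_sum rational_from_mult \<Psi>)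
  moreover have "(\<Sum>f\<in>FI_hom d n. \<Psi> n (trace_on d B f)) = (\<Sum>\<rho>\<in>R. \<Psi> n \<rho> * N n \<rho>)" if "n \<ge> m" for n
  proof -
    have "(\<Sum>f\<in>FI_hom d n. \<Psi> n (trace_on d B f))
        = (\<Sum>\<rho>\<in>R. \<Sum>f\<in>{g \<in> FI_hom d n. trace_on d B g = \<rho>}. \<Psi> n (trace_on d B f))"
      by (rule sum.group[symmetric, OF finite_FI_hom finR sub])
    then show ?thesis by (simp add: N_def mult.commute)
  qed
  ultimately show ?thesis by (rule rational_from_cong)
qed

section \<open>The lumped chain\<close>

text \<open>Both the overlap with f and the trace on \<open>A\<close> can be read off from the trace
  on \<open>A\<close> enlarged by the image of f. That set has at most d further labels, and d more
  must stay free, whence \<open>2 * d\<close>.\<close>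

lemma rational_from_sum_overlap:
  fixes \<Psi> :: "nat \<Rightarrow> (nat \<times> nat) set \<Rightarrow> (nat \<times> nat) set \<Rightarrow> real"
  assumes f: "f \<in> FI_hom d m" and A: "A \<subseteq> {1..m}" "card A + 2 * d \<le> m"
    and \<Psi>: "\<And>\<sigma> \<rho>. rational_from m (\<lambda>n. \<Psi> n \<sigma> \<rho>)"
  shows "rational_from m (\<lambda>n. \<Sum>h\<in>FI_hom d n. \<Psi> n (overlap d f h) (trace_on d A h))"
proof -
  let ?B = "A \<union> f ` {1..d}"
  have ov: "overlap d f h = {(i, j). i \<in> {1..d} \<and> (j, f i) \<in> trace_on d ?B h}" for h
    unfolding overlap_def trace_on_def by auto
  have tr: "trace_on d A h = {(i, b). (i, b) \<in> trace_on d ?B h \<and> b \<in> A}" for h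
    unfolding trace_on_def by auto
  have "card ?B \<le> card A + d"
    using card_Un_le[of A "f ` {1..d}"] card_image_le[of "{1..d}" f] by simp
  then show ?thesis
    unfolding ov tr using FI_hom_image[OF f] A
    by (intro rational_from_sum_FI_hom[of ?B m d "\<lambda>n \<rho>. \<Psi> n {(i, j). i \<in> {1..d} \<and> (j, f i) \<in> \<rho>} {(i, b). (i, b) \<in> \<rho> \<and> b \<in> A}"] \<Psi>)
      auto
qed

text \<open>The stable range of an FI-graph without its functor: vertices have names (w, f), and the
  criteria \<open>EQ\<close> and \<open>ED\<close> for equality and adjacency read only the overlap
  and take no argument n.\<close>

locale overlap_graphs =
  fixes d N :: nat and W :: "'u set" and H :: "nat \<Rightarrow> 'v graph"
    and gen :: "nat \<Rightarrow> (nat \<Rightarrow> nat) \<Rightarrow> 'u \<Rightarrow> 'v"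
    and EQ ED :: "'u \<Rightarrow> 'u \<Rightarrow> (nat \<times> nat) set \<Rightarrow> bool"
  assumes fin_W: "finite W"
    and graph_H: "n \<ge> N \<Longrightarrow> is_graph (H n)"
    and verts_H: "n \<ge> N \<Longrightarrow> verts (H n) = (\<lambda>(w, f). gen n f w) ` (W \<times> FI_hom d n)"
    and gen_eq_iff: "\<lbrakk>n \<ge> N; f \<in> FI_hom d n; f' \<in> FI_hom d n; w \<in> W; w' \<in> W\<rbrakk> \<Longrightarrow>
      gen n f w = gen n f' w' \<longleftrightarrow> EQ w w' (overlap d f f')"
    and edge_iff: "\<lbrakk>n \<ge> N; f \<in> FI_hom d n; f' \<in> FI_hom d n; w \<in> W; w' \<in> W\<rbrakk> \<Longrightarrow>
      {gen n f w, gen n f' w'} \<in> edges (H n) \<longleftrightarrow> ED w w' (overlap d f f')"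
begin

definition overlap_weight :: "'u \<Rightarrow> 'u \<Rightarrow> (nat \<times> nat) set \<Rightarrow> real" where
  "overlap_weight w w' \<sigma> = (if ED w w' \<sigma> then (if EQ w w' \<sigma> then 2 else 1) else 0)"

lemma weight_gen:
  assumes "n \<ge> N" "f \<in> FI_hom d n" "f' \<in> FI_hom d n" "w \<in> W" "w' \<in> W"
  shows "weight (H n) (gen n f w) (gen n f' w') = overlap_weight w w' (overlap d f f')"
  using gen_eq_iff[OF assms] edge_iff[OF assms] by (auto simp: weight_def overlap_weight_def)

text \<open>The number of names of the vertex named by w and the standard inclusion. By symmetry
  every embedding gives the same count, and this form exhibits it as a sum of functions of an
  overlap, to which the counting results apply.\<close>

definition fibre :: "nat \<Rightarrow> 'u \<Rightarrow> real" where
  "fibre n w = (\<Sum>w'\<in>W. \<Sum>h\<in>FI_hom d n. if EQ w w' (overlap d (FI_incl d) h) then 1 else 0)"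

lemma fibre_eq_card:
  assumes n: "n \<ge> N" "n \<ge> d" and f: "f \<in> FI_hom d n" "w \<in> W"
  shows "fibre n w = real (card {x \<in> W \<times> FI_hom d n. gen n (snd x) (fst x) = gen n f w})"
proof -
  have "(\<Sum>h\<in>FI_hom d n. if EQ w w' (overlap d (FI_incl d) h) then 1 else 0)
      = (\<Sum>h\<in>FI_hom d n. if EQ w w' (overlap d f h) then 1 else (0::real))" for w'
    by (rule sum_FI_hom_transport[where A = "{}" and \<Psi> = "\<lambda>\<sigma> _. if EQ w w' \<sigma> then 1 else 0"])
      (use FI_incl_in[OF n(2)] f in \<open>auto simp: trace_on_def\<close>)
  then have "fibre n w = (\<Sum>w'\<in>W. \<Sum>h\<in>FI_hom d n. if gen n h w' = gen n f w then 1 else 0)"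
    unfolding fibre_def using n f by (auto intro!: sum.cong simp: gen_eq_iff[symmetric])
  also have "\<dots> = (\<Sum>x\<in>W \<times> FI_hom d n. if gen n (snd x) (fst x) = gen n f w then 1 else 0)"
    by (simp add: sum.cartesian_product case_prod_unfold)
  finally show ?thesis using fin_W finite_FI_hom[of d n] by (simp add: sum.If_cases Int_def)
qed

lemma fibre_pos:
  assumes n: "n \<ge> N" "n \<ge> d" and w: "w \<in> W"
  shows "0 < fibre n w"
proof -
  have f: "FI_incl d \<in> FI_hom d n" using FI_incl_in n(2) .
  have "(w, FI_incl d) \<in> {x \<in> W \<times> FI_hom d n. gen n (snd x) (fst x) = gen n (FI_incl d) w}"
    using f w by simp
  moreover have "finite {x \<in> W \<times> FI_hom d n. gen n (snd x) (fst x) = gen n (FI_incl d) w}"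
    using fin_W finite_FI_hom[of d n] by simp
  ultimately show ?thesis unfolding fibre_eq_card[OF n f w] of_nat_0_less_iff card_gt_0_iff by blast
qed

text \<open>Each vertex is counted once for each of its names. Names of one vertex may have
  different generators, but their \<open>fibre\<close> values agree because all of them count the
  same set of names.\<close>

lemma sum_verts:
  fixes F :: "'v \<Rightarrow> real"
  assumes n: "n \<ge> N" "n \<ge> d"
  shows "(\<Sum>u\<in>verts (H n). F u) = (\<Sum>w\<in>W. \<Sum>h\<in>FI_hom d n. F (gen n h w) / fibre n w)"
proof -
  let ?P = "W \<times> FI_hom d n" and ?g = "\<lambda>x. gen n (snd x) (fst x)"
  have finP: "finite ?P" using fin_W finite_FI_hom[of d n] by simp
  have "(\<Sum>w\<in>W. \<Sum>h\<in>FI_hom d n. F (gen n h w) / fibre n w) = (\<Sum>x\<in>?P. F (?g x) / fibre n (fst x))"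
    by (simp add: sum.cartesian_product case_prod_unfold)
  also have "\<dots> = (\<Sum>u\<in>?g ` ?P. \<Sum>x\<in>{x \<in> ?P. ?g x = u}. F (?g x) / fibre n (fst x))"
    by (rule sum.image_gen[OF finP])
  also have "\<dots> = (\<Sum>u\<in>?g ` ?P. F u)"
  proof (rule sum.cong[OF refl])
    fix u assume "u \<in> ?g ` ?P"
    then have ne: "{x \<in> ?P. ?g x = u} \<noteq> {}" by blast
    have "(\<Sum>x\<in>{x \<in> ?P. ?g x = u}. F (?g x) / fibre n (fst x))
        = (\<Sum>x\<in>{x \<in> ?P. ?g x = u}. F u / real (card {x \<in> ?P. ?g x = u}))"
    proof (rule sum.cong[OF refl])
      fix x assume "x \<in> {x \<in> ?P. ?g x = u}"
      then have x: "fst x \<in> W" "snd x \<in> FI_hom d n" "?g x = u" by auto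
      show "F (?g x) / fibre n (fst x) = F u / real (card {x \<in> ?P. ?g x = u})"
        using fibre_eq_card[OF n x(2,1)] x(3) by simp
    qed
    also have "\<dots> = F u"
      using ne finite_subset[OF _ finP, of "{x \<in> ?P. ?g x = u}"] by (simp add: card_eq_0_iff)
    finally show "(\<Sum>x\<in>{x \<in> ?P. ?g x = u}. F (?g x) / fibre n (fst x)) = F u" .
  qed
  also have "?g ` ?P = verts (H n)"
    unfolding verts_H[OF n(1)] by (simp add: case_prod_unfold)
  finally show ?thesis ..
qed

end

text \<open>The states of the finite chain are the pairs of a generator \<open>w\<close> and the partial injection
  that an embedding induces into the fixed set \<open>A\<close> of labels occurring in the start and the target.
  All of them are realised by embeddings into \<open>{1..m}\<close>, so that neither the state set nor the
  representatives depend on \<open>n\<close>.\<close>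

locale overlap_walk = overlap_graphs d N W H gen EQ ED
  for d N :: nat and W :: "'u set" and H :: "nat \<Rightarrow> 'v graph"
    and gen :: "nat \<Rightarrow> (nat \<Rightarrow> nat) \<Rightarrow> 'u \<Rightarrow> 'v"
    and EQ ED :: "'u \<Rightarrow> 'u \<Rightarrow> (nat \<times> nat) set \<Rightarrow> bool" +
  fixes m :: nat and A :: "nat set" and f\<^sub>b :: "nat \<Rightarrow> nat" and w\<^sub>b :: 'u
  assumes m: "N \<le> m" "card A + 2 * d \<le> m" and A: "A \<subseteq> {1..m}"
    and f\<^sub>b: "f\<^sub>b \<in> FI_hom d m" "f\<^sub>b ` {1..d} \<subseteq> A" and w\<^sub>b: "w\<^sub>b \<in> W"
    and connected_H: "n \<ge> m \<Longrightarrow> connected_graph (H n)"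
begin

definition states :: "('u \<times> (nat \<times> nat) set) set" where
  "states = W \<times> trace_on d A ` FI_hom d m"

text \<open>Since \<open>f\<^sub>b\<close> takes its values in \<open>A\<close>, the trace on
  \<open>A\<close> determines the overlap with \<open>f\<^sub>b\<close>; the inner set is that
  overlap, so membership says that the named vertex is the target.\<close>

definition target_states :: "('u \<times> (nat \<times> nat) set) set" where
  "target_states = {(w, p). EQ w w\<^sub>b {(i, j). i \<in> {1..d} \<and> j \<in> {1..d} \<and> (i, f\<^sub>b j) \<in> p}}"

abbreviation target :: "nat \<Rightarrow> 'v" where
  "target n \<equiv> gen n f\<^sub>b w\<^sub>b"

definition rep :: "(nat \<times> nat) set \<Rightarrow> nat \<Rightarrow> nat" where
  "rep p = (SOME f. f \<in> FI_hom d m \<and> trace_on d A f = p)"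

text \<open>The weight from the represented vertex into a state. A neighbour with names in several
  states has its weight spread evenly over its names by the division through
  \<open>fibre\<close>.\<close>

definition state_weight ::
    "nat \<Rightarrow> 'u \<times> (nat \<times> nat) set \<Rightarrow> 'u \<times> (nat \<times> nat) set \<Rightarrow> real" where
  "state_weight n \<tau> \<tau>' = (\<Sum>h\<in>FI_hom d n.
     if trace_on d A h = snd \<tau>' then overlap_weight (fst \<tau>) (fst \<tau>') (overlap d (rep (snd \<tau>)) h) else 0)
     / fibre n (fst \<tau>')"

definition state_prob ::
    "nat \<Rightarrow> 'u \<times> (nat \<times> nat) set \<Rightarrow> 'u \<times> (nat \<times> nat) set \<Rightarrow> real" where
  "state_prob n \<tau> \<tau>' = state_weight n \<tau> \<tau>' / (\<Sum>\<tau>''\<in>states. state_weight n \<tau> \<tau>'')"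

lemma m_ge_d: "d \<le> m"
  using m(2) by simp

lemma A_subset: "n \<ge> m \<Longrightarrow> A \<subseteq> {1..n}"
  using A by auto

lemma f\<^sub>b_in: "n \<ge> m \<Longrightarrow> f\<^sub>b \<in> FI_hom d n"
  using f\<^sub>b(1) FI_hom_mono by blast

lemma finite_states: "finite states"
  using fin_W finite_FI_hom by (simp add: states_def)

lemma rep:
  assumes "p \<in> trace_on d A ` FI_hom d m"
  shows "rep p \<in> FI_hom d m" "trace_on d A (rep p) = p"
proof -
  have "\<exists>f. f \<in> FI_hom d m \<and> trace_on d A f = p" using assms by blast
  from someI_ex[OF this] show "rep p \<in> FI_hom d m" "trace_on d A (rep p) = p"
    unfolding rep_def by blast+
qed

lemma trace_in:
  assumes "f \<in> FI_hom d n"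
  shows "trace_on d A f \<in> trace_on d A ` FI_hom d m"
  using trace_on_image_subset[of A m d n] A m assms by fastforce

lemma rep_in:
  assumes "n \<ge> m" "p \<in> trace_on d A ` FI_hom d m"
  shows "rep p \<in> FI_hom d n"
  using rep(1)[OF assms(2)] FI_hom_mono[OF assms(1)] by blast

lemma target_iff:
  assumes "n \<ge> m" "f \<in> FI_hom d n" "w \<in> W"
  shows "gen n f w = target n \<longleftrightarrow> (w, trace_on d A f) \<in> target_states"
proof -
  have "overlap d f f\<^sub>b = {(i, j). i \<in> {1..d} \<and> j \<in> {1..d} \<and> (i, f\<^sub>b j) \<in> trace_on d A f}"
    unfolding overlap_def trace_on_def using f\<^sub>b(2) by auto
  then show ?thesis
    using gen_eq_iff[of n f f\<^sub>b w w\<^sub>b] assms m(1) f\<^sub>b_in w\<^sub>b by (simp add: target_states_def)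
qed

text \<open>Exactness of the lumping for functions that factor through the state: the vertex sum
  becomes a sum over names, a permutation fixing \<open>A\<close> replaces f by the representative
  of its trace, and the names are grouped by trace.\<close>

lemma sum_weight:
  assumes n: "n \<ge> m" and f: "f \<in> FI_hom d n" "w \<in> W"
    and F: "\<And>h w'. h \<in> FI_hom d n \<Longrightarrow> w' \<in> W \<Longrightarrow> F (gen n h w') = \<Phi> (w', trace_on d A h)"
  shows "(\<Sum>u\<in>verts (H n). weight (H n) (gen n f w) u * F u)
    = (\<Sum>\<tau>\<in>states. state_weight n (w, trace_on d A f) \<tau> * \<Phi> \<tau>)"
proof -
  have nN: "n \<ge> N" "n \<ge> d" using n m m_ge_d by auto
  let ?p = "trace_on d A f"
  let ?R = "trace_on d A ` FI_hom d m"
  have p: "?p \<in> ?R" using trace_in[OF f(1)] .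
  have inner: "(\<Sum>h\<in>FI_hom d n. weight (H n) (gen n f w) (gen n h w') * F (gen n h w') / fibre n w')
      = (\<Sum>p'\<in>?R. state_weight n (w, ?p) (w', p') * \<Phi> (w', p'))" if w': "w' \<in> W" for w'
  proof -
    have "(\<Sum>h\<in>FI_hom d n. weight (H n) (gen n f w) (gen n h w') * F (gen n h w') / fibre n w')
        = (\<Sum>h\<in>FI_hom d n. overlap_weight w w' (overlap d f h) * \<Phi> (w', trace_on d A h) / fibre n w')"
      using weight_gen[OF nN(1) f(1) _ f(2) w'] F[OF _ w'] by (intro sum.cong) auto
    also have "\<dots> = (\<Sum>h\<in>FI_hom d n. overlap_weight w w' (overlap d (rep ?p) h) * \<Phi> (w', trace_on d A h) / fibre n w')"
      by (rule sum_FI_hom_transport[where \<Psi> = "\<lambda>\<sigma> \<rho>. overlap_weight w w' \<sigma> * \<Phi> (w', \<rho>) / fibre n w'"])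
        (use f rep_in[OF n p] rep(2)[OF p] A_subset[OF n] in auto)
    also have "\<dots> = (\<Sum>p'\<in>?R. \<Sum>h\<in>{h \<in> FI_hom d n. trace_on d A h = p'}.
        overlap_weight w w' (overlap d (rep ?p) h) * \<Phi> (w', trace_on d A h) / fibre n w')"
      using trace_in by (intro sum.group[symmetric] finite_FI_hom finite_imageI) blast
    also have "\<dots> = (\<Sum>p'\<in>?R. state_weight n (w, ?p) (w', p') * \<Phi> (w', p'))"
    proof (rule sum.cong[OF refl])
      fix p'
      have "state_weight n (w, ?p) (w', p')
          = (\<Sum>h\<in>{h \<in> FI_hom d n. trace_on d A h = p'}. overlap_weight w w' (overlap d (rep ?p) h)) / fibre n w'"
        unfolding state_weight_def fst_conv snd_conv using finite_FI_hom by (simp add: sum.inter_filter)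
      then show "(\<Sum>h\<in>{h \<in> FI_hom d n. trace_on d A h = p'}.
            overlap_weight w w' (overlap d (rep ?p) h) * \<Phi> (w', trace_on d A h) / fibre n w')
          = state_weight n (w, ?p) (w', p') * \<Phi> (w', p')"
        by (simp add: sum_divide_distrib sum_distrib_right)
    qed
    finally show ?thesis .
  qed
  show ?thesis
    unfolding sum_verts[OF nN] states_def sum.cartesian_product[symmetric]
    by (simp add: inner sum.cartesian_product case_prod_unfold)
qed

lemma wdegree_gen:
  assumes "n \<ge> m" "f \<in> FI_hom d n" "w \<in> W"
  shows "wdegree (H n) (gen n f w) = (\<Sum>\<tau>\<in>states. state_weight n (w, trace_on d A f) \<tau>)"
  using sum_weight[OF assms, of "\<lambda>_. 1" "\<lambda>_. 1"] by (simp add: wdegree_def)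

lemma gen_in_verts:
  assumes "n \<ge> m" "f \<in> FI_hom d n" "w \<in> W"
  shows "gen n f w \<in> verts (H n)"
  using assms m(1) verts_H[of n] by force

text \<open>A path to the target leaves every other vertex along an edge. So the convention for
  vertices of degree 0 never applies off the target.\<close>

lemma wdegree_pos_gen:
  assumes n: "n \<ge> m" and f: "f \<in> FI_hom d n" "w \<in> W" and nt: "(w, trace_on d A f) \<notin> target_states"
  shows "0 < wdegree (H n) (gen n f w)"
proof -
  have "gen n f w \<noteq> target n" using target_iff[OF n f] nt by simp
  moreover have "(gen n f w, target n) \<in> {(a, b). {a, b} \<in> edges (H n)}\<^sup>*"
    using connected_H[OF n] gen_in_verts[OF n f] gen_in_verts[OF n f\<^sub>b_in[OF n] w\<^sub>b]
    unfolding connected_graph_def by blast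
  ultimately obtain u where "{gen n f w, u} \<in> edges (H n)"
    by (auto elim: converse_rtranclE)
  then show ?thesis using wdegree_pos graph_H n m(1) by (metis order_trans)
qed

lemma sum_step_prob_gen:
  assumes n: "n \<ge> m" and f: "f \<in> FI_hom d n" "w \<in> W" and nt: "(w, trace_on d A f) \<notin> target_states"
    and F: "\<And>h w'. h \<in> FI_hom d n \<Longrightarrow> w' \<in> W \<Longrightarrow> F (gen n h w') = \<Phi> (w', trace_on d A h)"
  shows "(\<Sum>u\<in>verts (H n). step_prob (H n) (gen n f w) u * F u)
    = (\<Sum>\<tau>\<in>states. state_prob n (w, trace_on d A f) \<tau> * \<Phi> \<tau>)"
proof -
  have "(\<Sum>u\<in>verts (H n). step_prob (H n) (gen n f w) u * F u)
      = (\<Sum>u\<in>verts (H n). weight (H n) (gen n f w) u * F u) / wdegree (H n) (gen n f w)"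
    using wdegree_pos_gen[OF n f nt] by (simp add: step_prob_def sum_divide_distrib)
  also have "\<dots> = (\<Sum>\<tau>\<in>states. state_prob n (w, trace_on d A f) \<tau> * \<Phi> \<tau>)"
    by (subst sum_weight[where F = F and \<Phi> = \<Phi>, OF n f F], assumption, assumption)
      (simp add: wdegree_gen[OF n f] state_prob_def sum_divide_distrib)
  finally show ?thesis .
qed

section \<open>Survival probabilities as functions of the state\<close>

definition state_survival :: "nat \<Rightarrow> nat \<Rightarrow> 'u \<times> (nat \<times> nat) set \<Rightarrow> real" where
  "state_survival t n \<tau> = survival (H n) (target n) t (gen n (rep (snd \<tau>)) (fst \<tau>))"

text \<open>The induction carries the bare existence of a factorisation through the state, which is
  what the lumped step requires. Evaluating the factor at the representative identifies it
  afterwards.\<close>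

lemma survival_gen:
  assumes n: "n \<ge> m" and f: "f \<in> FI_hom d n" "w \<in> W"
  shows "survival (H n) (target n) t (gen n f w) = state_survival t n (w, trace_on d A f)"
proof -
  have "\<exists>\<Phi>. \<forall>h\<in>FI_hom d n. \<forall>w\<in>W. survival (H n) (target n) t (gen n h w) = \<Phi> (w, trace_on d A h)"
  proof (induction t)
    case 0
    then show ?case
      using target_iff[OF n] by (intro exI[of _ "\<lambda>\<tau>. if \<tau> \<in> target_states then 0 else 1"]) auto
  next
    case (Suc t)
    then obtain \<Phi> where \<Phi>: "\<And>h w. h \<in> FI_hom d n \<Longrightarrow> w \<in> W \<Longrightarrow>
        survival (H n) (target n) t (gen n h w) = \<Phi> (w, trace_on d A h)" by blast
    show ?case
      using target_iff[OF n] sum_step_prob_gen[where F = "survival (H n) (target n) t" and \<Phi> = \<Phi>, OF n _ _ _ \<Phi>]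
      by (intro exI[of _ "\<lambda>\<tau>. if \<tau> \<in> target_states then 0 else \<Sum>\<tau>'\<in>states. state_prob n \<tau> \<tau>' * \<Phi> \<tau>'"]) auto
  qed
  then obtain \<Phi> where \<Phi>: "\<And>h w. h \<in> FI_hom d n \<Longrightarrow> w \<in> W \<Longrightarrow>
      survival (H n) (target n) t (gen n h w) = \<Phi> (w, trace_on d A h)" by blast
  note p = trace_in[OF f(1)]
  show ?thesis
    unfolding state_survival_def using \<Phi>[OF f] \<Phi>[OF rep_in[OF n p] f(2)] rep(2)[OF p] by simp
qed

lemma state_survival_target:
  assumes "n \<ge> m" "\<tau> \<in> states" "\<tau> \<in> target_states"
  shows "state_survival t n \<tau> = 0"
proof -
  have "fst \<tau> \<in> W" and p: "snd \<tau> \<in> trace_on d A ` FI_hom d m" using assms(2) by (auto simp: states_def)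
  then have "gen n (rep (snd \<tau>)) (fst \<tau>) = target n"
    using target_iff[OF assms(1) rep_in[OF assms(1) p], of "fst \<tau>"] assms(3) rep(2)[OF p] by simp
  then show ?thesis by (cases t) (auto simp: state_survival_def)
qed

lemma state_survival_Suc:
  assumes n: "n \<ge> m" and \<tau>: "\<tau> \<in> states - target_states"
  shows "state_survival 0 n \<tau> = 1"
    and "state_survival (Suc t) n \<tau> = (\<Sum>\<tau>'\<in>states - target_states. state_prob n \<tau> \<tau>' * state_survival t n \<tau>')"
proof -
  define f where "f = rep (snd \<tau>)"
  have p: "snd \<tau> \<in> trace_on d A ` FI_hom d m" and w: "fst \<tau> \<in> W" using \<tau> by (auto simp: states_def)
  have f: "f \<in> FI_hom d n" "(fst \<tau>, trace_on d A f) = \<tau>"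
    using rep_in[OF n p] rep(2)[OF p] by (auto simp: f_def)
  have nt: "gen n f (fst \<tau>) \<noteq> target n" using target_iff[OF n f(1) w] f(2) \<tau> by auto
  then show "state_survival 0 n \<tau> = 1" by (simp add: state_survival_def f_def)
  have "state_survival (Suc t) n \<tau> = (\<Sum>u\<in>verts (H n). step_prob (H n) (gen n f (fst \<tau>)) u * survival (H n) (target n) t u)"
    using nt by (simp add: state_survival_def f_def)
  also have "\<dots> = (\<Sum>\<tau>'\<in>states. state_prob n \<tau> \<tau>' * state_survival t n \<tau>')"
    using sum_step_prob_gen[OF n f(1) w, of "survival (H n) (target n) t" "state_survival t n"]
      survival_gen[OF n] f(2) \<tau> by auto
  also have "\<dots> = (\<Sum>\<tau>'\<in>states - target_states. state_prob n \<tau> \<tau>' * state_survival t n \<tau>')"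
    using state_survival_target[OF n] finite_states by (intro sum.mono_neutral_right) auto
  finally show "state_survival (Suc t) n \<tau> = (\<Sum>\<tau>'\<in>states - target_states. state_prob n \<tau> \<tau>' * state_survival t n \<tau>')" .
qed

section \<open>Rationality in n of the finite chain\<close>

lemma fibre_rational: "rational_from m (\<lambda>n. fibre n w)"
  unfolding fibre_def
  by (intro rational_from_sum
      rational_from_sum_overlap[where A = "{}" and \<Psi> = "\<lambda>n \<sigma> \<rho>. if EQ w _ \<sigma> then 1 else 0"]
      rational_from_const FI_incl_in[OF m_ge_d])
    (use m in auto)

lemma state_weight_rational:
  assumes "\<tau> \<in> states" "\<tau>' \<in> states"
  shows "rational_from m (\<lambda>n. state_weight n \<tau> \<tau>')"
proof -
  have "rep (snd \<tau>) \<in> FI_hom d m" using assms rep(1) by (auto simp: states_def)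
  then have "rational_from m (\<lambda>n. \<Sum>h\<in>FI_hom d n.
     if trace_on d A h = snd \<tau>' then overlap_weight (fst \<tau>) (fst \<tau>') (overlap d (rep (snd \<tau>)) h) else 0)"
    by (intro rational_from_sum_overlap[where \<Psi> = "\<lambda>n \<sigma> \<rho>. if \<rho> = snd \<tau>' then overlap_weight (fst \<tau>) (fst \<tau>') \<sigma> else 0"]
        rational_from_const A m(2))
  moreover have "fibre n (fst \<tau>') \<noteq> 0" if "n \<ge> m" for n
    using fibre_pos[of n "fst \<tau>'"] that m m_ge_d assms(2) by (force simp: states_def)
  ultimately show ?thesis unfolding state_weight_def by (intro rational_from_divide fibre_rational)
qed

lemma state_weight_nonneg:
  assumes "n \<ge> m" "\<tau>' \<in> states"
  shows "0 \<le> state_weight n \<tau> \<tau>'"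
proof -
  have "0 \<le> fibre n (fst \<tau>')"
    unfolding fibre_def by (intro sum_nonneg) auto
  then show ?thesis
    unfolding state_weight_def by (intro divide_nonneg_nonneg sum_nonneg) (auto simp: overlap_weight_def)
qed

text \<open>The normalising sum is the degree of the represented vertex, which is positive at every
  n \<ge> m because the state is not a target.\<close>

lemma state_prob_rational:
  assumes "\<tau> \<in> states - target_states" "\<tau>' \<in> states"
  shows "rational_from m (\<lambda>n. state_prob n \<tau> \<tau>')"
  unfolding state_prob_def
proof (intro rational_from_divide rational_from_sum state_weight_rational)
  fix n assume n: "n \<ge> m"
  have p: "snd \<tau> \<in> trace_on d A ` FI_hom d m" and w: "fst \<tau> \<in> W" using assms(1) by (auto simp: states_def)
  have "(fst \<tau>, trace_on d A (rep (snd \<tau>))) = \<tau>" using rep(2)[OF p] by simp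
  then show "(\<Sum>\<tau>'\<in>states. state_weight n \<tau> \<tau>') \<noteq> 0"
    using wdegree_gen[OF n rep_in[OF n p] w] wdegree_pos_gen[OF n rep_in[OF n p] w] assms(1) by auto
qed (use assms in auto)

lemma rational_from_survival:
  assumes f: "f \<in> FI_hom d m" and w: "w \<in> W"
  shows "rational_from m (\<lambda>n. \<Sum>t. real t ^ i * survival (H n) (target n) t (gen n f w))"
proof -
  let ?\<tau> = "(w, trace_on d A f)"
  have \<tau>: "?\<tau> \<in> states" using f w by (simp add: states_def)
  have fn: "f \<in> FI_hom d n" if "n \<ge> m" for n using f FI_hom_mono[OF that] by blast
  have "rational_from m (\<lambda>n. \<Sum>t. real t ^ i * state_survival t n ?\<tau>)"
  \<comment> \<open>A start state among the targets is outside the index set of the linear system;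
    its survival is identically 0.\<close>
  proof (cases "?\<tau> \<in> target_states")
    case True
    then have "(\<Sum>t. real t ^ i * state_survival t n ?\<tau>) = 0" if "n \<ge> m" for n
      using state_survival_target[OF that \<tau>] by simp
    then show ?thesis by (intro rational_from_cong[OF rational_from_const[of m 0]])
  next
    case False
    show ?thesis
    proof (rule rational_from_tail_moments[where S = "states - target_states" and Q = state_prob])
      show "0 \<le> state_prob n s t" if "n \<ge> m" "s \<in> states - target_states" "t \<in> states - target_states" for n s t
        unfolding state_prob_def using that
        by (intro divide_nonneg_nonneg sum_nonneg state_weight_nonneg) auto
      show "\<exists>C r. 0 \<le> r \<and> r < 1 \<and> (\<forall>k. \<forall>s\<in>states - target_states. \<bar>state_survival k n s\<bar> \<le> C * r ^ k)"
        if n: "n \<ge> m" for n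
      proof -
        obtain C r where Cr: "0 < r" "r < 1" "\<And>t v. v \<in> verts (H n) \<Longrightarrow> survival (H n) (target n) t v \<le> C * r ^ t"
          using survival_geometric[of "H n" "target n"] graph_H[of n] connected_H[OF n] n m(1)
            gen_in_verts[OF n f\<^sub>b_in[OF n] w\<^sub>b] by (metis order_trans)
        have "\<bar>state_survival k n s\<bar> \<le> C * r ^ k" if "s \<in> states" for k s
        proof -
          have p: "snd s \<in> trace_on d A ` FI_hom d m" and w: "fst s \<in> W" using that by (auto simp: states_def)
          show ?thesis
            unfolding state_survival_def
            using Cr(3)[OF gen_in_verts[OF n rep_in[OF n p] w], of k]
            unfolding abs_of_nonneg[OF survival_nonneg] .
        qed
        then show ?thesis using Cr(1,2) by (intro exI[of _ C] exI[of _ r]) auto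
      qed
    qed (use finite_states state_prob_rational state_survival_Suc \<tau> False in auto)
  qed
  then show ?thesis
    by (rule rational_from_cong) (simp add: survival_gen[OF _ fn w])
qed

end

section \<open>FI-graphs\<close>

context FI_graph
begin

lemma Gmap_in_verts: "f \<in> FI_hom m n \<Longrightarrow> v \<in> verts (G m) \<Longrightarrow> Gmap m n f v \<in> verts (G n)"
  using hom[of f m n] unfolding graph_hom_def by blast

lemma Gmap_edge:
  assumes "f \<in> FI_hom m n" "{u, v} \<in> edges (G m)"
  shows "{Gmap m n f u, Gmap m n f v} \<in> edges (G n)"
  using hom[OF assms(1)] assms(2) unfolding graph_hom_def by fastforce

lemma Gmap_FI_incl:
  assumes "f \<in> FI_hom d m" "m \<le> n" "w \<in> verts (G d)"
  shows "Gmap m n (FI_incl m) (Gmap d m f w) = Gmap d n f w"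
  using map_comp[OF assms(1) FI_incl_in[OF assms(2)] assms(3)] compose_FI_incl[OF assms(1)] by simp

text \<open>Generation is given one level at a time; functoriality collapses the successive
  injections into a single one from level d.\<close>

lemma verts_generated:
  assumes gen: "\<And>n v. n \<ge> d \<Longrightarrow> v \<in> verts (G (Suc n)) \<Longrightarrow> \<exists>f\<in>FI_hom n (Suc n). v \<in> Gmap n (Suc n) f ` verts (G n)"
    and n: "n \<ge> d"
  shows "verts (G n) = (\<lambda>(w, f). Gmap d n f w) ` (verts (G d) \<times> FI_hom d n)"
proof
  show "verts (G n) \<subseteq> (\<lambda>(w, f). Gmap d n f w) ` (verts (G d) \<times> FI_hom d n)"
    using n
  proof (induction n rule: dec_induct)
    case base
    show ?case
    proof
      fix v assume v: "v \<in> verts (G d)"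
      then show "v \<in> (\<lambda>(w, f). Gmap d d f w) ` (verts (G d) \<times> FI_hom d d)"
        by (intro image_eqI[of _ _ "(v, FI_incl d)"]) (auto simp: map_id FI_incl_in)
    qed
  next
    case (step n)
    show ?case
    proof
      fix v assume "v \<in> verts (G (Suc n))"
      then obtain g u where g: "g \<in> FI_hom n (Suc n)" "u \<in> verts (G n)" "v = Gmap n (Suc n) g u"
        using gen[OF step.hyps(1)] by blast
      obtain w f where f: "w \<in> verts (G d)" "f \<in> FI_hom d n" "u = Gmap d n f w"
        using step.IH g(2) by auto
      show "v \<in> (\<lambda>(w, f). Gmap d (Suc n) f w) ` (verts (G d) \<times> FI_hom d (Suc n))"
        using f g map_comp[OF f(2) g(1) f(1)] compose_FI_hom[OF f(2) g(1)]
        by (intro image_eqI[of _ _ "(w, compose {1..d} g f)"]) auto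
    qed
  qed
qed (auto intro: Gmap_in_verts)

text \<open>An FI-invariant relation between translates of generators depends only on their overlap once a
  witness has appeared, and only finitely many overlaps have to be awaited.\<close>

lemma relation_stabilizes:
  fixes R :: "nat \<Rightarrow> 'v \<Rightarrow> 'v \<Rightarrow> bool"
  assumes R: "\<And>k n f u v. f \<in> FI_hom k n \<Longrightarrow> u \<in> verts (G k) \<Longrightarrow> v \<in> verts (G k) \<Longrightarrow>
      R k u v \<Longrightarrow> R n (Gmap k n f u) (Gmap k n f v)"
  shows "\<exists>N S. \<forall>n\<ge>N. \<forall>f\<in>FI_hom d n. \<forall>f'\<in>FI_hom d n. \<forall>w\<in>verts (G d). \<forall>w'\<in>verts (G d).
      R n (Gmap d n f w) (Gmap d n f' w') \<longleftrightarrow> S w w' (overlap d f f')"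
proof -
  define S where "S w w' \<sigma> \<longleftrightarrow> (\<exists>n. \<exists>f\<in>FI_hom d n. \<exists>f'\<in>FI_hom d n. overlap d f f' = \<sigma> \<and>
      R n (Gmap d n f w) (Gmap d n f' w'))" for w w' \<sigma>
  \<comment> \<open>Only the implication from \<open>S\<close> to \<open>R\<close> has to wait for
    large n; the converse is the definition of \<open>S\<close>.\<close>
  define P where "P n x \<longleftrightarrow> (case x of (w, w', \<sigma>) \<Rightarrow> S w w' \<sigma> \<longrightarrow>
      (\<forall>f\<in>FI_hom d n. \<forall>f'\<in>FI_hom d n. overlap d f f' = \<sigma> \<longrightarrow> R n (Gmap d n f w) (Gmap d n f' w')))" for n x
  let ?X = "verts (G d) \<times> verts (G d) \<times> Pow ({1..d} \<times> {1..d})"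
  have "\<forall>x\<in>?X. eventually (\<lambda>n. P n x) sequentially"
  proof
    fix x assume "x \<in> ?X"
    then obtain w w' \<sigma> where x: "x = (w, w', \<sigma>)" "w \<in> verts (G d)" "w' \<in> verts (G d)" by auto
    show "eventually (\<lambda>n. P n x) sequentially"
    proof (cases "S w w' \<sigma>")
      case False
      then show ?thesis by (simp add: P_def x)
    next
      case True
      then obtain k g g' where g: "g \<in> FI_hom d k" "g' \<in> FI_hom d k" "overlap d g g' = \<sigma>"
        "R k (Gmap d k g w) (Gmap d k g' w')" unfolding S_def by blast
      have "P n x" if n: "n \<ge> k" for n
      proof -
        have gn: "g \<in> FI_hom d n" "g' \<in> FI_hom d n" using g(1,2) FI_hom_mono[OF n] by blast+
        have "R n (Gmap k n (FI_incl k) (Gmap d k g w)) (Gmap k n (FI_incl k) (Gmap d k g' w'))"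
          using R[OF FI_incl_in[OF n] Gmap_in_verts[OF g(1) x(2)] Gmap_in_verts[OF g(2) x(3)] g(4)] .
        then have Rn: "R n (Gmap d n g w) (Gmap d n g' w')"
          unfolding Gmap_FI_incl[OF g(1) n x(2)] Gmap_FI_incl[OF g(2) n x(3)] .
        have "R n (Gmap d n f w) (Gmap d n f' w')"
          if f: "f \<in> FI_hom d n" "f' \<in> FI_hom d n" "overlap d f f' = \<sigma>" for f f'
        proof -
          have "overlap d g g' = overlap d f f'" using g(3) f(3) by simp
          then obtain \<pi> where \<pi>: "\<pi> \<in> FI_hom n n" "compose {1..d} \<pi> g = f" "compose {1..d} \<pi> g' = f'"
            by (rule overlap_transport[OF gn f(1,2)]) (rule that)
          have "R n (Gmap n n \<pi> (Gmap d n g w)) (Gmap n n \<pi> (Gmap d n g' w'))"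
            using R[OF \<pi>(1) Gmap_in_verts[OF gn(1) x(2)] Gmap_in_verts[OF gn(2) x(3)] Rn] .
          then show ?thesis
            using map_comp[OF gn(1) \<pi>(1) x(2)] map_comp[OF gn(2) \<pi>(1) x(3)] \<pi>(2,3) by simp
        qed
        then show ?thesis by (simp add: P_def x)
      qed
      then show ?thesis unfolding eventually_sequentially by blast
    qed
  qed
  moreover have "finite ?X" using graph[of d] by (simp add: is_graph_def)
  ultimately have "eventually (\<lambda>n. \<forall>x\<in>?X. P n x) sequentially"
    using eventually_ball_finite by blast
  then obtain N where N: "\<And>n x. n \<ge> N \<Longrightarrow> x \<in> ?X \<Longrightarrow> P n x"
    unfolding eventually_sequentially by blast
  show ?thesis
  proof (intro exI[of _ N] exI[of _ S] allI impI ballI)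
    fix n f f' w w' assume *: "n \<ge> N" "f \<in> FI_hom d n" "f' \<in> FI_hom d n" "w \<in> verts (G d)" "w' \<in> verts (G d)"
    have "overlap d f f' \<in> Pow ({1..d} \<times> {1..d})" unfolding overlap_def by auto
    then have "P n (w, w', overlap d f f')" using N[OF *(1), of "(w, w', overlap d f f')"] * by blast
    then show "R n (Gmap d n f w) (Gmap d n f' w') \<longleftrightarrow> S w w' (overlap d f f')"
      using * by (auto simp: P_def S_def)
  qed
qed

text \<open>Equality is preserved by every map and adjacency by graph homomorphisms, so both are
  invariant relations that stabilize; the larger of the two thresholds serves for both.\<close>

lemma ex_overlap_graphs:
  assumes "finitely_generated G Gmap"
  shows "\<exists>d N EQ ED. overlap_graphs d N (verts (G d)) G (Gmap d) EQ ED"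
proof -
  obtain d where d: "\<And>n v. n \<ge> d \<Longrightarrow> v \<in> verts (G (Suc n)) \<Longrightarrow> \<exists>f\<in>FI_hom n (Suc n). v \<in> Gmap n (Suc n) f ` verts (G n)"
    using assms unfolding finitely_generated_def by blast
  obtain N EQ where EQ: "\<forall>n\<ge>N. \<forall>f\<in>FI_hom d n. \<forall>f'\<in>FI_hom d n. \<forall>w\<in>verts (G d). \<forall>w'\<in>verts (G d).
      (Gmap d n f w = Gmap d n f' w') \<longleftrightarrow> EQ w w' (overlap d f f')"
    using relation_stabilizes[of "\<lambda>_. (=)" d] by auto
  obtain N' ED where ED: "\<forall>n\<ge>N'. \<forall>f\<in>FI_hom d n. \<forall>f'\<in>FI_hom d n. \<forall>w\<in>verts (G d). \<forall>w'\<in>verts (G d).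
      {Gmap d n f w, Gmap d n f' w'} \<in> edges (G n) \<longleftrightarrow> ED w w' (overlap d f f')"
    using relation_stabilizes[of "\<lambda>n u v. {u, v} \<in> edges (G n)" d, OF Gmap_edge] by blast
  have "overlap_graphs d (max d (max N N')) (verts (G d)) G (Gmap d) EQ ED"
  proof
    show "finite (verts (G d))" using graph[of d] by (simp add: is_graph_def)
    show "verts (G n) = (\<lambda>(w, f). Gmap d n f w) ` (verts (G d) \<times> FI_hom d n)" if "n \<ge> max d (max N N')" for n
      by (rule verts_generated[OF d]) (use that in simp_all)
    show "is_graph (G n)" for n by (rule graph)
  next
    fix n f f' w w'
    assume *: "n \<ge> max d (max N N')" "f \<in> FI_hom d n" "f' \<in> FI_hom d n" "w \<in> verts (G d)" "w' \<in> verts (G d)"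
    then have n: "n \<ge> N" "n \<ge> N'" by simp_all
    show "Gmap d n f w = Gmap d n f' w' \<longleftrightarrow> EQ w w' (overlap d f f')"
      by (rule EQ[rule_format, OF n(1) *(2-5)])
    show "{Gmap d n f w, Gmap d n f' w'} \<in> edges (G n) \<longleftrightarrow> ED w w' (overlap d f f')"
      by (rule ED[rule_format, OF n(2) *(2-5)])
  qed
  then show ?thesis by blast
qed

end

theorem theoremA:
  fixes G :: "nat \<Rightarrow> 'v graph"
    and Gmap :: "nat \<Rightarrow> nat \<Rightarrow> (nat \<Rightarrow> nat) \<Rightarrow> 'v \<Rightarrow> 'v"
  assumes "FI_graph G Gmap"
    and "finitely_generated G Gmap"
    and "\<exists>N. \<forall>n\<ge>N. connected_graph (G n)"
  shows "\<exists>m\<^sub>0. \<forall>m\<ge>m\<^sub>0. \<forall>x\<in>verts (G m). \<forall>y\<in>verts (G m).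
    \<forall>(M :: nat \<Rightarrow> 'w measure) (X :: nat \<Rightarrow> nat \<Rightarrow> 'w \<Rightarrow> 'v).
      (\<forall>n\<ge>m. simple_random_walk (M n) (G n) (Gmap m n (FI_incl m) x) (X n)) \<longrightarrow>
      (let \<tau> = (\<lambda>n. hitting_time (X n) (Gmap m n (FI_incl m) y));
           \<tau>\<^sub>r = (\<lambda>n. hitting_time_real (X n) (Gmap m n (FI_incl m) y))
       in (\<forall>n\<ge>m. (AE \<omega> in M n. \<tau> n \<omega> < \<infinity>) \<and> has_mgf (M n) (\<tau>\<^sub>r n)) \<and>
          (\<forall>i\<ge>1. rational_from m (\<lambda>n. moment (M n) (\<tau>\<^sub>r n) i) \<and>
                 rational_from m (\<lambda>n. central_moment (M n) (\<tau>\<^sub>r n) i) \<and>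
                 rational_from m (\<lambda>n. cumulant (M n) (\<tau>\<^sub>r n) i)))"
proof -
  interpret FI_graph G Gmap by fact
  obtain d N EQ ED where og: "overlap_graphs d N (verts (G d)) G (Gmap d) EQ ED"
    using ex_overlap_graphs[OF assms(2)] by blast
  interpret overlap_graphs d N "verts (G d)" G "Gmap d" EQ ED by fact
  obtain N' where conn: "\<And>n. n \<ge> N' \<Longrightarrow> connected_graph (G n)" using assms(3) by blast
  show ?thesis
    unfolding Let_def
  \<comment> \<open>The bounds secure the stable range, connectedness, and
    \<open>card A + 2 * d\<close> \<le> m, where \<open>A\<close> is the union of two images of size
    at most d.\<close>
  proof (rule exI[of _ "max N (max N' (4 * d))"], intro allI ballI impI)
    fix m x y and M :: "nat \<Rightarrow> 'w measure" and X :: "nat \<Rightarrow> nat \<Rightarrow> 'w \<Rightarrow> 'v"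
    assume "max N (max N' (4 * d)) \<le> m" and x: "x \<in> verts (G m)" and y: "y \<in> verts (G m)"
      and walk: "\<forall>n\<ge>m. simple_random_walk (M n) (G n) (Gmap m n (FI_incl m) x) (X n)"
    then have m: "N \<le> m" "N' \<le> m" "4 * d \<le> m" by auto
    define b where "b n = Gmap m n (FI_incl m) y" for n
    obtain w\<^sub>x f\<^sub>x where fx: "w\<^sub>x \<in> verts (G d)" "f\<^sub>x \<in> FI_hom d m" "x = Gmap d m f\<^sub>x w\<^sub>x"
      using x verts_H[OF m(1)] by auto
    obtain w\<^sub>y f\<^sub>y where fy: "w\<^sub>y \<in> verts (G d)" "f\<^sub>y \<in> FI_hom d m" "y = Gmap d m f\<^sub>y w\<^sub>y"
      using y verts_H[OF m(1)] by auto
    \<comment> \<open>Standard inclusions do not change names: x(n) and y(n) are named by the same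
      pairs at every n \<ge> m.\<close>
    have xn: "Gmap m n (FI_incl m) x = Gmap d n f\<^sub>x w\<^sub>x" and yn: "b n = Gmap d n f\<^sub>y w\<^sub>y" if "n \<ge> m" for n
      unfolding b_def using fx fy that by (simp_all add: Gmap_FI_incl)
    define A where "A = f\<^sub>x ` {1..d} \<union> f\<^sub>y ` {1..d}"
    have "card A \<le> d + d"
      unfolding A_def using card_Un_le[of "f\<^sub>x ` {1..d}" "f\<^sub>y ` {1..d}"]
        card_image_le[of "{1..d}" f\<^sub>x] card_image_le[of "{1..d}" f\<^sub>y] by simp
    then interpret overlap_walk d N "verts (G d)" G "Gmap d" EQ ED m A f\<^sub>y w\<^sub>y
      using m fy conn FI_hom_image[OF fx(2)] FI_hom_image[OF fy(2)] by unfold_locales (auto simp: A_def)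
    have "\<exists>C r. 0 < r \<and> r < 1 \<and> (\<forall>t. \<forall>v\<in>verts (G n). survival (G n) (b n) t v \<le> C * r ^ t)" if n: "n \<ge> m" for n
      using survival_geometric[OF graph] connected_H[OF n] gen_in_verts[OF n f\<^sub>b_in[OF n] w\<^sub>b] yn[OF n] by simp
    then obtain C r where Cr: "\<And>n. n \<ge> m \<Longrightarrow> 0 < r n \<and> r n < 1 \<and>
        (\<forall>t. \<forall>v\<in>verts (G n). survival (G n) (b n) t v \<le> C n * r n ^ t)"
      by metis
    have tail: "hitting_tail (M n) (X n) (b n) (\<lambda>t. survival (G n) (b n) t (Gmap d n f\<^sub>x w\<^sub>x)) (C n) (r n)"
      if n: "n \<ge> m" for n
    proof -
      have w: "simple_random_walk (M n) (G n) (Gmap d n f\<^sub>x w\<^sub>x) (X n)" using walk n xn by metis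
      interpret prob_space "M n" using w by (simp add: simple_random_walk_def)
      have "Gmap d n f\<^sub>x w\<^sub>x \<in> verts (G n)"
        using gen_in_verts[OF n _ fx(1)] fx(2) FI_hom_mono[OF n] by blast
      then show ?thesis
        using random_walk_survival[OF graph w] Cr[OF n] by unfold_locales auto
    qed
    have rat: "rational_from m (\<lambda>n. \<Sum>t. real t ^ i * survival (G n) (b n) t (Gmap d n f\<^sub>x w\<^sub>x))" for i
      by (rule rational_from_cong[OF rational_from_survival[OF fx(2,1), of i]]) (simp add: yn)
    show "(\<forall>n\<ge>m. (AE \<omega> in M n. hitting_time (X n) (Gmap m n (FI_incl m) y) \<omega> < \<infinity>) \<and>
          has_mgf (M n) (hitting_time_real (X n) (Gmap m n (FI_incl m) y))) \<and>
        (\<forall>i\<ge>1. rational_from m (\<lambda>n. moment (M n) (hitting_time_real (X n) (Gmap m n (FI_incl m) y)) i) \<and>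
          rational_from m (\<lambda>n. central_moment (M n) (hitting_time_real (X n) (Gmap m n (FI_incl m) y)) i) \<and>
          rational_from m (\<lambda>n. cumulant (M n) (hitting_time_real (X n) (Gmap m n (FI_incl m) y)) i))"
      unfolding b_def[symmetric]
      by (intro conjI allI impI hitting_tail.AE_hit[OF tail] hitting_tail.has_mgf_hit[OF tail]
          rational_from_hitting_time[OF tail rat])
  qed
qed

end
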